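(* Let $R$ be a ring in which every element is the sum of two commuting 2-idempotents. Then for every positive integer $n$, every $n\times n$ matrix over $R$ is the sum of two tripotent matrices and a nilpotent matrix.
   Context: All rings are associative with an identity, not necessarily commutative. An element $e$ of a ring is a 2-idempotent if $e^2$ is an idempotent, i.e. $e^2=e^4$. An element $t$ of a ring is tripotent if $t^3=t$; tripotent and nilpotent matrices are tripotent and nilpotent elements of the matrix ring $M_n(R)$. No commutativity among the three summands is asserted. *)

theory Defs
  imports "Jordan_Normal_Form.Matrix"
begin

(* The sort {ring, monoid_mult} is that of associative rings with identity, not necessarily
   commutative. Unlike ring_1 it does not assume 0 \<noteq> 1, so the zero ring is included. *)

definition idempotent_elem :: "'a :: {ring, monoid_mult} \<Rightarrow> bool" where
  "idempotent_elem e \<longleftrightarrow> e ^ 2 = e"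

definition two_idempotent :: "'a :: {ring, monoid_mult} \<Rightarrow> bool" where
  "two_idempotent e \<longleftrightarrow> idempotent_elem (e ^ 2)"

lemma two_idempotent_iff: "two_idempotent e \<longleftrightarrow> e ^ 2 = e ^ 4"
  by (auto simp: two_idempotent_def idempotent_elem_def simp flip: power_mult)

definition tripotent_mat :: "nat \<Rightarrow> 'a :: {ring, monoid_mult} mat \<Rightarrow> bool" where
  "tripotent_mat n T \<longleftrightarrow> T \<in> carrier_mat n n \<and> T * T * T = T"

(* The power N^k is written as a k-fold multiplication of the identity matrix by N,
   because pow_mat is available over semiring_1 only, which excludes the zero ring. *)
definition nilpotent_mat :: "nat \<Rightarrow> 'a :: {ring, monoid_mult} mat \<Rightarrow> bool" where
  "nilpotent_mat n N \<longleftrightarrow>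
     N \<in> carrier_mat n n \<and> (\<exists>k. ((\<lambda>X. X * N) ^^ k) (1\<^sub>m n) = 0\<^sub>m n n)"

lemma nilpotent_mat_iff_pow_mat:
  fixes N :: "'a :: ring_1 mat"
  shows "nilpotent_mat n N \<longleftrightarrow> N \<in> carrier_mat n n \<and> (\<exists>k. N ^\<^sub>m k = 0\<^sub>m n n)"
proof -
  have "((\<lambda>X. X * N) ^^ k) (1\<^sub>m n) = N ^\<^sub>m k" if "N \<in> carrier_mat n n" for k
    using that by (induction k) auto
  then show ?thesis
    by (auto simp: nilpotent_mat_def)
qed

end

theory Submission
  imports Defs "HOL-Library.Product_Plus" "HOL-Library.Z2" "HOL-Computational_Algebra.Primes"
    "HOL-Number_Theory.Cong"
begin

text \<open>Let \<open>K\<close> be the prime radical of \<open>R\<close>, the intersection of all semiprime ideals. The matrix is decomposed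
over \<open>R / K\<close>, where the structure is rigid enough to reduce to matrices over the fields with 2, 3 and
5 elements, and the decomposition is then lifted along \<open>R \<rightarrow> R / K\<close>.

The quotient. In any ring, \<open>x = e + f\<close> with commuting 2-idempotents satisfies
\<open>(x (x\<^sup>2 - 1) (x\<^sup>2 - 4))\<^sup>3 = 0\<close>, because \<open>e\<^sup>3\<close> and \<open>f\<^sup>3\<close> are commuting tripotents whose sum is a root of
the quintic \<open>x (x\<^sup>2 - 1) (x\<^sup>2 - 4)\<close>, and \<open>e - e\<^sup>3\<close>, \<open>f - f\<^sup>3\<close> square to zero. For \<open>x = 3\<close> this makes \<open>30\<close> nilpotent. In a semiprime
ring, 30 therefore vanishes, and a nonzero element of square zero would produce a system of
two by two matrix units (\<open>square_zero\<close>), hence an element with \<open>w\<^sup>2 = w + 13\<close> on it, whose characteristic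
polynomial has no root modulo 2, 3 or 5, against the quintic. So the semiprime quotient is reduced; its
idempotents are central, its 2-idempotents are tripotent, tripotents are combinations of idempotents, and
the quotient is commutative (\<open>commutative\<close>).

Matrices over the quotient. What is constructed is a splitting \<open>A = (p - q) + (p' - q') + c\<close> with
orthogonal idempotents \<open>p, q\<close> and \<open>p', q'\<close> and nilpotent \<open>c\<close>; a difference of two orthogonal idempotents is
tripotent. Splittings on orthogonal central idempotents \<open>e, f\<close> add up to one on \<open>e + f\<close>. Cutting 1 into finitely
many idempotents, every entry of \<open>A\<close> becomes an integer multiple of \<open>e\<close> with \<open>p e = 0\<close> for a prime \<open>p \<le> 5\<close>
(\<open>integral_induct\<close>). There transvections bring \<open>A\<close> to a form in which each column either vanishes below
the diagonal or vanishes outside the first subdiagonal (\<open>splits_F_mat\<close>), a triangular arrangement of companion matrices.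
A diagonal entry of this form lies in \<open>{-2, ..., 2}\<close>, so it is a sum of two elements of
\<open>{-1, 0, 1}\<close> the first of which is nonzero; the splitting can then be written down (\<open>splits_good\<close>).

Lifting. Differences of orthogonal idempotents, unlike general tripotents, lift modulo a nil ideal
even when 2 is not invertible (\<open>lift_splits\<close>). That matrices over \<open>K\<close> are nilpotent follows from the local
nilpotence of \<open>K\<close>: finitely many elements of \<open>K\<close> have only zero products of some length
(\<open>prime_radical_locally_nilpotent\<close>). That \<open>K\<close> contains all that has to be killed is ensured by
\<open>semiprime_bounded_nil\<close>, where the uniform nilpotency exponent from the quintic is essential.

Matrices are treated as elements of a ring type of row-finite infinite matrices, in which the \<open>n \<times> n\<close>
matrices form a corner. Finally, \<open>R\<close> is replaced by \<open>R \<times> F\<^sub>2\<close>, which satisfies the same hypothesis and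
is never the zero ring.\<close>

section \<open>Elements that are sums of two commuting 2-idempotents\<close>

definition sum_of_commuting_2idem :: "'a::ring_1 \<Rightarrow> bool" where
  "sum_of_commuting_2idem x \<longleftrightarrow>
     (\<exists>e f. e ^ 4 = e ^ 2 \<and> f ^ 4 = f ^ 2 \<and> e * f = f * e \<and> x = e + f)"

lemma triple: "3 * x = x + (x + x)" for x :: "'a::ring_1"
proof -
  have "(3 :: 'a) = 1 + (1 + 1)" by simp
  then show ?thesis by (simp only: distrib_right mult_1_left)
qed

lemma numeral_commute: "x * numeral k = numeral k * x" for x :: "'a::ring_1"
  by (metis mult_of_nat_commute of_nat_numeral)

lemma numeral_mult_comm: "x * (numeral k * y) = numeral k * (x * y)" for x :: "'a::ring_1"
  by (metis mult.assoc mult_of_nat_commute of_nat_numeral)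

lemma two_idem_minus_cube:
  fixes a :: "'a::ring_1"
  assumes "a ^ 4 = a ^ 2"
  shows "(a ^ 3) ^ 3 = a ^ 3" "(a - a ^ 3) ^ 2 = 0"
proof -
  have 5: "a ^ 5 = a ^ 3"
    using arg_cong[OF assms, of "\<lambda>x. a * x"] by (simp add: eval_nat_numeral)
  have 6: "a ^ 6 = a ^ 2"
    using arg_cong[OF 5, of "\<lambda>x. a * x"] assms by (simp add: eval_nat_numeral)
  have "(a ^ 3) ^ 3 = a ^ 5 * a ^ 4"
    by (simp flip: power_mult power_add)
  also have "\<dots> = a ^ 5"
    using 5 assms by (simp flip: power_add)
  finally show "(a ^ 3) ^ 3 = a ^ 3"
    using 5 by simp
  have "(a - a ^ 3) ^ 2 = a ^ 2 - a ^ 4 - a ^ 4 + a ^ 6"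
    by (simp add: eval_nat_numeral algebra_simps)
  with assms 6 show "(a - a ^ 3) ^ 2 = 0"
    by simp
qed

text \<open>The possible values of \<open>t + s\<close> are \<open>-2, ..., 2\<close>, the roots of \<open>X\<^sup>5 - 5 X\<^sup>3 + 4 X\<close>. In characteristic 30 they are
roots of \<open>X\<^sup>5 - X\<close> as well; \<open>y\<^sup>5 - y\<close> itself may be nonzero when 2 is not invertible, since tripotents
modulo 2 need not be semisimple, and only its square vanishes.\<close>

lemma sum_commuting_tripotents:
  fixes t s :: "'a::ring_1"
  assumes t: "t * (t * t) = t" and s: "s * (s * s) = s" and c: "s * t = t * s"
  defines "y \<equiv> t + s"
  shows "y ^ 5 - 5 * y ^ 3 + 4 * y = 0"
    and "(30 :: 'a) = 0 \<Longrightarrow> (y ^ 5 - y) ^ 2 = 0"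
proof -
  have cc: "s * (t * z) = t * (s * z)" for z
    by (metis c mult.assoc)
  have tt: "t * (t * (t * z)) = t * z" for z
    by (metis t mult.assoc)
  have ss: "s * (s * (s * z)) = s * z" for z
    by (metis s mult.assoc)
  note rules = t s c cc tt ss algebra_simps
  define m where "m = t * (t * s) + t * (s * s)"
  have y3: "y ^ 3 = y + 3 * m"
    by (simp add: y_def m_def eval_nat_numeral triple rules)
  define z where "z = t * s + t * (t * (s * s))"
  have ym: "y * m = 2 * z"
    by (simp add: y_def m_def z_def mult_2 rules)
  have "y * z = 2 * m"
    by (simp add: y_def m_def z_def mult_2 rules)
  with ym have "y * (y * m) = 4 * m"
    by (simp add: numeral_mult_comm[of y] flip: mult.assoc[of 2])
  moreover have "y ^ 5 = y * (y * y ^ 3)"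
    by (simp add: eval_nat_numeral)
  moreover have "y * (y * (3 * m)) = 3 * (y * (y * m))"
    by (simp add: triple algebra_simps)
  ultimately have "y ^ 5 = y * (y * y) + 3 * (4 * m)"
    unfolding y3 by (simp add: distrib_left)
  then have y5: "y ^ 5 = y ^ 3 + 12 * m"
    by (simp add: power3_eq_cube mult.assoc flip: mult.assoc[of 3 4])
  show "y ^ 5 - 5 * y ^ 3 + 4 * y = 0"
    using distrib_right[of 1 4 y] distrib_right[of 3 12 m]
    unfolding y5 y3 by (simp add: distrib_left flip: mult.assoc)
  assume 30: "(30 :: 'a) = 0"
  have "y ^ 5 - y = 15 * m"
    using distrib_right[of 3 12 m] unfolding y5 y3 by simp
  moreover have "m * m = 2 * (t * (t * (s * s)) + t * s)"
    by (simp add: m_def mult_2 rules)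
  ultimately have "(y ^ 5 - y) ^ 2 = 450 * (t * (t * (s * s)) + t * s)"
    by (simp add: power2_eq_square mult.assoc numeral_mult_comm[of m] flip: mult.assoc[of "numeral i" "numeral j" for i j])
  also have "450 = (30 * 15 :: 'a)" by simp
  finally show "(y ^ 5 - y) ^ 2 = 0" using 30 by simp
qed

lemma power_mult_distrib_commuting:
  fixes a b :: "'a::monoid_mult"
  assumes "a * b = b * a"
  shows "(a * b) ^ k = a ^ k * b ^ k"
proof (induction k)
  case (Suc k)
  have "b * a ^ k = a ^ k * b"
    using assms by (rule power_commuting_commutes[symmetric])
  then have "a * (b * (a ^ k * b ^ k)) = a * (a ^ k * (b * b ^ k))"
    by (metis mult.assoc)
  with Suc show ?case
    by (simp add: mult.assoc)
qed simp

lemma power_diff_commuting: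
  fixes x y :: "'a::ring_1"
  assumes "x * y = y * x"
  shows "\<exists>g. x ^ k - y ^ k = (x - y) * g \<and> g * x = x * g \<and> g * y = y * g"
proof (induction k)
  case 0
  show ?case by (rule exI[of _ 0]) simp
next
  case (Suc k)
  then obtain g where g: "x ^ k - y ^ k = (x - y) * g" "g * x = x * g" "g * y = y * g"
    by blast
  have "y * (x - y) = (x - y) * y"
    using assms by (simp add: algebra_simps)
  then have "y * ((x - y) * g) = (x - y) * (y * g)"
    by (metis mult.assoc)
  moreover have "x ^ Suc k - y ^ Suc k = (x - y) * x ^ k + y * (x ^ k - y ^ k)"
    by (simp add: algebra_simps)
  ultimately have "x ^ Suc k - y ^ Suc k = (x - y) * (x ^ k + y * g)"
    using g(1) by (simp only: distrib_left)
  moreover have "x ^ k * y = y * x ^ k"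
    using assms by (simp add: power_commuting_commutes)
  then have "(x ^ k + y * g) * x = x * (x ^ k + y * g)" "(x ^ k + y * g) * y = y * (x ^ k + y * g)"
    using g assms
    by (simp_all add: distrib_left distrib_right power_commutes)
       (metis mult.assoc, metis mult.assoc)
  ultimately show ?case by blast
qed

text \<open>The exponents are the same for all \<open>x\<close>; this uniformity is what later makes nilpotent elements lie in the
prime radical.\<close>

lemma quintic_nilpotent:
  fixes x :: "'a::ring_1"
  assumes "sum_of_commuting_2idem x"
  shows "(x ^ 5 - 5 * x ^ 3 + 4 * x) ^ 3 = 0"
    and "(30 :: 'a) = 0 \<Longrightarrow> (x ^ 5 - x) ^ 4 = 0"
proof -
  obtain e f where ef: "e ^ 4 = e ^ 2" "f ^ 4 = f ^ 2" "e * f = f * e" "x = e + f"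
    using assms unfolding sum_of_commuting_2idem_def by blast
  \<comment> \<open>The tripotent part of x; the remainder n has cube zero, being a sum of two commuting elements of square zero.\<close>
  define y where "y = e ^ 3 + f ^ 3"
  define n where "n = x - y"
  define c d where "c = e - e ^ 3" and "d = f - f ^ 3"
  have pc: "e ^ i * f ^ j = f ^ j * e ^ i" for i j
    using ef(3) by (metis power_commuting_commutes)
  have pc': "e * f ^ j = f ^ j * e" "e ^ i * f = f * e ^ i" for i j
    using pc[of 1 j] pc[of i 1] by simp_all
  have "c * c = 0" "d * d = 0"
    using two_idem_minus_cube(2)[OF ef(1)] two_idem_minus_cube(2)[OF ef(2)]
    by (simp_all add: c_def d_def power2_eq_square)
  moreover have cd: "d * c = c * d"
    unfolding c_def d_def by (simp add: left_diff_distrib right_diff_distrib pc pc' ef(3))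
  moreover have "d * (c * z) = c * (d * z)" for z
    by (metis cd mult.assoc)
  moreover have "c * (c * z) = 0" for z
    by (metis \<open>c * c = 0\<close> mult.assoc mult_zero_left)
  moreover have "n = c + d"
    by (simp add: n_def c_def d_def y_def ef(4))
  ultimately have n3: "n ^ 3 = 0"
    by (simp add: eval_nat_numeral algebra_simps)
  have xy: "x * y = y * x"
    by (simp add: ef(4) y_def distrib_left distrib_right pc pc' flip: power_Suc power_Suc2)
  have "e ^ 3 * (e ^ 3 * e ^ 3) = e ^ 3" "f ^ 3 * (f ^ 3 * f ^ 3) = f ^ 3"
    using two_idem_minus_cube(1)[OF ef(1)] two_idem_minus_cube(1)[OF ef(2)]
    by (simp_all add: power3_eq_cube mult.assoc)
  note y = sum_commuting_tripotents[OF this pc[symmetric], folded y_def]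
  \<comment> \<open>Replacing y by x = y + n changes the value of a polynomial by a multiple of n.\<close>
  obtain g5 where g5: "x ^ 5 - y ^ 5 = n * g5" "g5 * x = x * g5" "g5 * y = y * g5"
    using power_diff_commuting[OF xy] unfolding n_def by blast
  obtain g3 where g3: "x ^ 3 - y ^ 3 = n * g3" "g3 * x = x * g3" "g3 * y = y * g3"
    using power_diff_commuting[OF xy] unfolding n_def by blast
  define G where "G = g5 - 5 * g3 + 4"
  have "n * G = (x ^ 5 - y ^ 5) - 5 * (x ^ 3 - y ^ 3) + 4 * (x - y)"
    unfolding G_def g5 g3 
    by (simp add: distrib_left right_diff_distrib numeral_mult_comm[of n])
       (simp add: n_def algebra_simps numeral_commute[of x] numeral_commute[of y])
  also have "\<dots> = x ^ 5 - 5 * x ^ 3 + 4 * x - (y ^ 5 - 5 * y ^ 3 + 4 * y)"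
    by (simp add: algebra_simps)
  finally have "x ^ 5 - 5 * x ^ 3 + 4 * x = n * G"
    using y(1) by simp
  moreover have "n * G = G * n"
  proof -
    have "n * g5 = g5 * n" "n * g3 = g3 * n"
      unfolding n_def using g5 g3 by (simp_all add: left_diff_distrib right_diff_distrib)
    moreover have "n * 4 = 4 * n" 
      by (rule numeral_commute)
    ultimately show ?thesis
      unfolding G_def 
      by (simp add: distrib_left distrib_right right_diff_distrib left_diff_distrib
          numeral_mult_comm[of n] mult.assoc)
  qed
  ultimately show "(x ^ 5 - 5 * x ^ 3 + 4 * x) ^ 3 = 0"
    by (simp add: power_mult_distrib_commuting n3)
  assume 30: "(30 :: 'a) = 0"
  define a b where "a = y ^ 5 - y" and "b = n * (g5 - 1)"
  have ab: "x ^ 5 - x = a + b"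
    using g5(1) by (simp add: a_def b_def n_def algebra_simps)
  have ny: "n * y = y * n" using xy by (simp add: n_def algebra_simps)
  have ng: "n * (g5 - 1) = (g5 - 1) * n"
    using g5 by (simp add: n_def algebra_simps)
  have "b * y = y * b"
    unfolding b_def using g5(3) ny
    by (simp add: algebra_simps) (metis mult.assoc)
  then have ba: "b * a = a * b"
    unfolding a_def by (simp add: left_diff_distrib right_diff_distrib power_commuting_commutes)
  then have ba': "b * (a * z) = a * (b * z)" for z
    by (metis mult.assoc)
  have b3: "b * (b * b) = 0"
    using arg_cong[OF power_mult_distrib_commuting[OF ng, of 3], of "\<lambda>z. z"] n3
    unfolding b_def by (metis mult.assoc mult_zero_left power3_eq_cube)
  then have b3': "b * (b * (b * z)) = 0" for z
    by (metis mult.assoc mult_zero_left)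
  have a2: "a * a = 0" using y(2)[OF 30] by (simp add: a_def power2_eq_square)
  then have a2': "a * (a * z) = 0" for z
    by (metis mult.assoc mult_zero_left)
  show "(x ^ 5 - x) ^ 4 = 0"
    unfolding ab by (simp add: eval_nat_numeral algebra_simps ba ba' b3 b3' a2 a2')
qed

section \<open>Semiprime rings of such elements are commutative\<close>

text \<open>The variable \<open>R\<close> only names the type of the ring under consideration.\<close>

context
  fixes R :: "'a::ring_1 itself"
  assumes semiprime: "\<And>a::'a. (\<And>r. a * r * a = 0) \<Longrightarrow> a = 0"
begin

text \<open>The exponent \<open>m\<close> is lowered by induction. With \<open>b = (u a)\<^bsup>m-1\<^esup> u\<close>, expanding \<open>(u a + b r)\<^sup>m u = 0\<close> and multiplying from the left by a power of
\<open>b r\<close> isolates the single term \<open>(b r)\<^bsup>m-1\<^esup> b\<close>. Hence \<open>b = 0\<close> by induction, for every \<open>a\<close>, which is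
the hypothesis on \<open>u\<close> with \<open>m - 1\<close> in place of \<open>m\<close>.\<close>

lemma semiprime_bounded_nil:
  fixes u :: 'a
  assumes "\<And>r. (u * r) ^ m * u = 0"
  shows "u = 0"
  using assms
proof (induction m arbitrary: u rule: less_induct)
  case (less m)
  consider "m = 0" | "m = 1" | k where "m = k + 2"
    by (metis One_nat_def add_2_eq_Suc' not0_implies_Suc)
  then show ?case
  proof cases
    case 1
    then show ?thesis using less.prems by simp
  next
    case 2
    then have "u * r * u = 0" for r using less.prems[of r] by simp
    then show ?thesis by (rule semiprime)
  next
    case 3
    have "(u * a) ^ (k + 1) * u = 0" for a
    proof (rule less.IH[of "k + 1"])
      fix r
      define x where "x = u * a"
      define y where "y = x ^ (k + 1) * u * r"
      have xu: "x ^ (k + 2) * u = 0"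
        using less.prems[of a] 3 by (simp add: x_def)
      have "y = u * (a * x ^ k * u * r)"
        by (simp add: y_def x_def mult.assoc)
      then have "(x + y) ^ (k + 2) * u = 0" and yu: "y ^ (k + 2) * u = 0"
        using less.prems[of "a + a * x ^ k * u * r"] less.prems[of "a * x ^ k * u * r"] 3
        by (simp_all add: x_def distrib_left)
      have xy: "x * y = 0"
        using xu by (simp add: y_def flip: mult.assoc)
      have xpy: "x ^ Suc i * y = 0" for i
        using xy by (simp add: power_Suc2 mult.assoc del: power_Suc)
      (* Since xy = 0, the expansion of (x + y)^n only contains the words y^i x^(n - i). *)
      have expand: "(x + y) ^ n = (\<Sum>i\<le>n. y ^ i * x ^ (n - i))" for n
      proof (induction n)
        case (Suc n)
        have "(x + y) ^ Suc n = (x + y) ^ n * x + (x + y) ^ n * y"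
          by (simp add: power_Suc2 distrib_left del: power_Suc)
        also have "(x + y) ^ n * y = (\<Sum>i\<le>n. if i = n then y ^ Suc n else 0)"
          unfolding Suc sum_distrib_right
        proof (rule sum.cong[OF refl])
          fix i assume "i \<in> {..n}"
          then consider "i = n" | j where "n - i = Suc j" by (metis Suc_diff_Suc atMost_iff le_neq_implies_less)
          then show "y ^ i * x ^ (n - i) * y = (if i = n then y ^ Suc n else 0)"
            by cases (auto simp: mult.assoc xpy power_commutes simp del: power_Suc, simp add: power_commutes)
        qed
        also have "\<dots> = y ^ Suc n" by simp
        also have "(x + y) ^ n * x = (\<Sum>i\<le>n. y ^ i * x ^ (Suc n - i))"
          unfolding Suc sum_distrib_right
          by (rule sum.cong) (auto simp: mult.assoc Suc_diff_le power_commutes)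
        finally show ?case by simp
      qed simp
      have "0 = y ^ k * ((x + y) ^ (k + 2) * u)"
        using \<open>(x + y) ^ (k + 2) * u = 0\<close> by simp
      also have "\<dots> = (\<Sum>i\<le>k + 2. if i = 1 then y ^ (k + 1) * x ^ (k + 1) * u else 0)"
        unfolding expand sum_distrib_right sum_distrib_left
      proof (rule sum.cong[OF refl])
        fix i assume "i \<in> {..k + 2}"
        consider "i = 0" | "i = 1" | j where "i = j + 2"
          by (metis One_nat_def add_2_eq_Suc' not0_implies_Suc)
        then show "y ^ k * (y ^ i * x ^ (k + 2 - i) * u) =
            (if i = 1 then y ^ (k + 1) * x ^ (k + 1) * u else 0)"
        proof cases
          case 1
          then show ?thesis using xu by simp
        next
          case 2
          then show ?thesis by (simp add: mult.assoc power_commutes) (metis mult.assoc power_commutes)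
        next
          case 3
          have "\<exists>v. x ^ (k + 2 - i) * u = u * v"
          proof (cases "k + 2 - i")
            case 0
            then show ?thesis by (intro exI[of _ 1]) simp
          next
            case (Suc l)
            then show ?thesis by (auto simp: x_def mult.assoc)
          qed
          then obtain v where v: "x ^ (k + 2 - i) * u = u * v" ..
          have "y ^ k * (y ^ i * x ^ (k + 2 - i) * u) = (y ^ k * y ^ i) * (u * v)"
            by (simp only: mult.assoc v)
          also have "y ^ k * y ^ i = y ^ j * y ^ (k + 2)"
            by (simp only: 3 power_add[symmetric] add.left_commute)
          finally have "y ^ k * (y ^ i * x ^ (k + 2 - i) * u) = y ^ j * (y ^ (k + 2) * u) * v"
            by (simp only: mult.assoc)
          then show ?thesis using yu 3 by simp
        qed
      qed
      also have "\<dots> = y ^ (k + 1) * x ^ (k + 1) * u" by simp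
      finally show "((u * a) ^ (k + 1) * u * r) ^ (k + 1) * ((u * a) ^ (k + 1) * u) = 0"
        by (simp add: x_def y_def mult.assoc)
    qed (use 3 in simp)
    moreover have "k + 1 < m" using 3 by simp
    ultimately show ?thesis by (rule less.IH[rotated])
  qed
qed

lemma semiprime_nilpotent_of_nat:
  assumes "(of_nat c :: 'a) ^ k = 0"
  shows "(of_nat c :: 'a) = 0"
proof (rule semiprime_bounded_nil)
  fix r :: 'a
  have "(of_nat c * r) ^ k = of_nat c ^ k * r ^ k"
    by (rule power_mult_distrib_commuting) (simp add: mult_of_nat_commute)
  then show "(of_nat c * r) ^ k * of_nat c = 0"
    using assms by (metis mult_zero_left)
qed

context
  assumes dec: "\<And>x::'a. sum_of_commuting_2idem x"
begin

lemma thirty_eq_0: "(30 :: 'a) = 0"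
proof -
  \<comment> \<open>The quintic takes the value 120 at 3, and 30 has the same prime divisors as 120.\<close>
  have "(120 :: 'a) ^ 3 = 0"
    using quintic_nilpotent(1)[OF dec, of 3] by simp
  moreover have "(30 :: 'a) ^ 9 = 120 ^ 3 * 11390625" by simp
  ultimately have "(30 :: 'a) ^ 9 = 0" by (metis mult_zero_left)
  then show ?thesis using semiprime_nilpotent_of_nat[of 30 9] by simp
qed


text \<open>Since \<open>w\<^sup>4 (w\<^sup>4 - 1)\<^sup>4 = 0\<close>, the element \<open>1 - (w\<^sup>4 - 1)\<^sup>4\<close> is the Fitting idempotent of \<open>w\<close>: it is a right multiple of
\<open>w\<close>, and \<open>w\<close> is nilpotent on its complement.\<close>

lemma idempotent_multiple:
  fixes w :: 'a
  shows "\<exists>e g. e * e = e \<and> e = w * g \<and> w ^ 4 * e = w ^ 4"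
proof -
  have "(w ^ 5 - w) ^ 4 = (w * (w ^ 4 - 1)) ^ 4"
    by (simp add: eval_nat_numeral algebra_simps)
  also have "\<dots> = w ^ 4 * (w ^ 4 - 1) ^ 4"
    by (rule power_mult_distrib_commuting) (simp add: algebra_simps power_commutes)
  finally have 0: "w ^ 4 * (w ^ 4 - 1) ^ 4 = 0"
    using quintic_nilpotent(2)[OF dec thirty_eq_0] by simp
  obtain g where g: "1 ^ 4 - (1 - w ^ 4) ^ 4 = (1 - (1 - w ^ 4)) * g"
    "g * (1 - w ^ 4) = (1 - w ^ 4) * g"
    using power_diff_commuting[of 1 "1 - w ^ 4" 4] by auto
  define e where "e = w ^ 4 * g"
  have "e = 1 - (w ^ 4 - 1) ^ 4"
    using g(1) by (simp add: e_def power_minus_even[of 4 "w ^ 4 - 1", simplified])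
  then have we: "w ^ 4 * e = w ^ 4"
    using 0 by (simp add: right_diff_distrib)
  have "g * w ^ 4 = w ^ 4 * g"
    using g(2) by (simp add: algebra_simps)
  then have "e * e = e"
    using we unfolding e_def by (metis mult.assoc)
  moreover have "e = w * (w ^ 3 * g)"
    by (simp add: e_def eval_nat_numeral mult.assoc)
  ultimately show ?thesis
    using we by blast
qed

text \<open>By \<open>semiprime_bounded_nil\<close> it suffices that \<open>z r\<close> is nilpotent of bounded index, which means that its Fitting
idempotent \<open>e = z s\<close> vanishes. From \<open>z\<^sup>2 = 0\<close> the elements \<open>e\<close>, \<open>u = e z\<close>, \<open>v = (1 - e) s e\<close>, \<open>v u\<close> are the
matrix units \<open>E\<^sub>1\<^sub>1, E\<^sub>1\<^sub>2, E\<^sub>2\<^sub>1, E\<^sub>2\<^sub>2\<close> of a ring of two by two matrices with unit \<open>i\<close>. The matrix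
\<open>w = E\<^sub>1\<^sub>1 + 13 E\<^sub>1\<^sub>2 + E\<^sub>2\<^sub>1\<close> satisfies \<open>w\<^sup>2 = w + 13\<close>. The number 13 is chosen such that \<open>X\<^sup>2 - X - 13\<close>, of
discriminant 53, is irreducible modulo each of 2, 3 and 5, so that the quintic is invertible at \<open>w\<close>.\<close>

lemma square_zero:
  fixes z :: 'a
  assumes zz: "z * z = 0"
  shows "z = 0"
proof (rule semiprime_bounded_nil)
  fix r
  obtain e g where ee: "e * e = e" and "e = z * r * g" and we: "(z * r) ^ 4 * e = (z * r) ^ 4"
    using idempotent_multiple by blast
  then obtain s where e: "e = z * s"
    by (metis mult.assoc)
  define u v where "u = e * z" and "v = (1 - e) * s * e"
  have ze: "z * e = 0"
    using zz by (simp add: e flip: mult.assoc)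
  have uv: "u * v = e"
  proof -
    have "u * v = e * (z * s) * e - e * (z * e) * (s * e)"
      by (simp add: u_def v_def algebra_simps)
    then show ?thesis by (simp add: ze ee flip: e)
  qed
  have ue: "u * e = 0" and eu: "e * u = u" and ve: "v * e = v" and ev: "e * v = 0"
    using ze ee by (simp_all add: u_def v_def left_diff_distrib right_diff_distrib mult.assoc)
      (simp_all add: ee flip: mult.assoc)
  have uu: "u * u = 0" and vv: "v * v = 0"
    using ue ve ev eu by (metis mult.assoc mult_zero_left mult_zero_right)+
  define i where "i = e + v * u"
  define w where "w = e + 13 * u + v"
  note rules = ee uv ue eu ve ev uu vv
  have assocs: "e * (e * x) = e * x" "u * (v * x) = e * x" "u * (e * x) = 0" "e * (u * x) = u * x"
    "v * (e * x) = v * x" "e * (v * x) = 0" "u * (u * x) = 0" "v * (v * x) = 0" for x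
    using rules by (metis mult.assoc mult_zero_left)+
  have 13: "x * (13 * y) = 13 * (x * y)" "x * 13 = 13 * x" for x y :: 'a
    by (rule numeral_mult_comm, rule numeral_commute)
  have wi: "w * i = w" and iw: "i * w = w" and ii: "i * i = i"
    unfolding w_def i_def using rules assocs 13[of v] 13[of e] 13[of u]
    by (simp_all add: algebra_simps)
  have ww: "w * w = w + 13 * i"
    unfolding w_def i_def using rules assocs 13[of v] 13[of e] 13[of u]
    by (simp add: algebra_simps)
  \<comment> \<open>Computation in the basis (w, i) of the commutative ring generated by w.\<close>
  have step: "w * (of_int a * w + of_int b * i) = of_int (a + b) * w + of_int (13 * a) * i" for a b
  proof -
    have "w * (of_int a * w + of_int b * i) = of_int a * (w * w) + of_int b * (w * i)"
      by (simp add: distrib_left) (metis mult.assoc mult_of_int_commute)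
    also have "\<dots> = of_int (a + b) * w + of_int (13 * a) * i"
      unfolding ww wi by (simp add: algebra_simps 13)
    finally show ?thesis .
  qed
  have "w ^ 3 = w * (w * w)"
    by (simp add: power3_eq_cube mult.assoc)
  then have w3: "w ^ 3 = of_int 14 * w + of_int 13 * i"
    using step[of 1 13] by (simp add: ww)
  have "w ^ 5 = w * (w * w ^ 3)"
    by (simp add: eval_nat_numeral)
  then have w5: "w ^ 5 = of_int 209 * w + of_int 351 * i"
    unfolding w3 step by simp
  define q where "q = w ^ 5 - 5 * w ^ 3 + 4 * w"
  have "q = 209 * w + 351 * i - 5 * (14 * w + 13 * i) + 4 * w"
    unfolding q_def w5 w3 by simp
  also have "\<dots> = (209 * w + 4 * w) + 351 * i - (70 * w + 65 * i)"
    by (simp add: distrib_left flip: mult.assoc)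
  also have "\<dots> = 143 * w + 286 * i"
    using distrib_right[of 209 4 w] distrib_right[of 70 143 w] distrib_right[of 65 286 i] by simp
  finally have q: "q = of_int 143 * w + of_int 286 * i" by simp
  \<comment> \<open>The quintic has the value 143 (w + 2), and (w + 2) (w - 3) = w^2 - w - 6 = 7; the product 1001 = 143 * 7 is prime to 30.\<close>
  have "w * q = q * w"
    by (simp add: q_def algebra_simps power_commutes 13 numeral_mult_comm[of w])
  moreover have "q * i = q" "i * q = q"
    unfolding q using wi iw ii 
    by (simp_all add: distrib_right distrib_left mult.assoc numeral_mult_comm[of i])
  ultimately have "q * (w - 3 * i) = (w - 3 * i) * q"
    by (simp add: algebra_simps numeral_mult_comm[of q])
  moreover have "q ^ 3 = 0"
    using quintic_nilpotent(1)[OF dec] by (simp add: q_def)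
  ultimately have "(q * (w - 3 * i)) ^ 3 = 0"
    by (simp add: power_mult_distrib_commuting)
  moreover have "q * (w - 3 * i) = of_int 1001 * i"
  proof -
    have "q * (w - 3 * i) = w * q - 3 * q"
      using \<open>w * q = q * w\<close> \<open>q * i = q\<close>
      by (simp add: right_diff_distrib numeral_mult_comm[of q])
    also have "w * q = of_int 429 * w + of_int 1859 * i"
      unfolding q step by simp
    also have "3 * q = of_int 429 * w + of_int 858 * i"
      unfolding q by (simp add: distrib_left flip: mult.assoc)
    finally show ?thesis
      using left_diff_distrib[of 1859 858 i] by simp
  qed
  ultimately have "of_int (1001 ^ 3) * i = 0"
    using ii by (simp add: power3_eq_cube mult.assoc numeral_mult_comm[of i] flip: mult.assoc[of "numeral a" "numeral b" for a b])
  moreover have "i = 11 * (of_int (1001 ^ 3) * i) - (30 * 367767767) * i"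
    using left_diff_distrib[of 11033033011 11033033010 i] by (simp flip: mult.assoc)
  ultimately have "i = 0"
    using thirty_eq_0 by (metis diff_self mult_zero_left mult_zero_right)
  then have "e = 0"
    using ee assocs by (metis add_cancel_right_right distrib_left ev i_def mult.assoc mult_zero_left mult_zero_right)
  then show "(z * r) ^ 4 * z = 0"
    using we by (metis mult_zero_left mult_zero_right)
qed

lemma idempotent_central:
  fixes e :: 'a
  assumes "e * e = e"
  shows "e * x = x * e"
proof -
  have ee: "e * (e * y) = e * y" for y
    using assms by (metis mult.assoc)
  have "e * x * (1 - e) = 0" "(1 - e) * x * e = 0"
    by (rule square_zero, simp add: algebra_simps ee assms)+
  then have "e * x = e * x * e" "x * e = e * x * e"
    by (simp_all add: right_diff_distrib left_diff_distrib)
  then show ?thesis by metis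
qed

text \<open>The element \<open>g\<close> plays the role of \<open>(t\<^sup>2 + t) / 2\<close>, the idempotent on which \<open>t = 1\<close>; the factor 8 is
one half modulo 15. Modulo 2 it is 0, in accordance with \<open>t = -t\<^sup>2\<close> there.\<close>

lemma tripotent_split:
  fixes t :: 'a
  assumes t: "t * (t * t) = t"
  defines "g \<equiv> 8 * (t * t + t)"
  shows "g * g = g" "t * g = g" "t * (t * t - g) = - (t * t - g)"
proof -
  define d where "d = t * t + t"
  have tt: "t * (t * (t * z)) = t * z" for z
    using t by (metis mult.assoc)
  have dd: "d * d = 2 * d" and td: "t * d = d"
    unfolding d_def by (simp_all add: algebra_simps t tt mult_2)
  have "(15 * d) * (15 * d) = (30 * 15) * d"
    using dd by (simp add: mult.assoc numeral_mult_comm[of d] flip: mult.assoc[of "numeral a" "numeral b" for a b])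
  then have "(15 * d) * (15 * d) = 0"
    by (simp only: thirty_eq_0 mult_zero_left)
  then have 15: "15 * d = 0"
    by (rule square_zero)
  have gd: "g = 8 * d" by (simp add: g_def d_def)
  have 16: "16 * d = d"
    using 15 distrib_right[of 15 1 d] by simp
  have "g * g = 8 * (16 * d)"
    unfolding gd using dd 
    by (simp add: mult.assoc numeral_mult_comm[of d] flip: mult.assoc[of "numeral a" "numeral b" for a b])
  then show "g * g = g" by (simp add: 16 gd)
  show tg: "t * g = g" by (simp add: gd numeral_mult_comm[of t] td)
  have "g + g = d"
    using 16 distrib_right[of 8 8 d] by (simp add: gd)
  then show "t * (t * t - g) = - (t * t - g)"
    using tg t by (simp add: right_diff_distrib d_def algebra_simps)
qed

lemma tripotent_central:
  fixes t :: 'a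
  assumes t: "t * (t * t) = t"
  shows "t * x = x * t"
proof -
  define g where "g = 8 * (t * t + t)"
  note ts = tripotent_split[OF t, folded g_def]
  have "t * t * (t * t) = t * t"
    using t by (metis mult.assoc)
  then have "t * t * x = x * (t * t)"
    by (rule idempotent_central)
  moreover have "g * x = x * g"
    using ts(1) by (rule idempotent_central)
  moreover have "t = g + g - t * t"
    using ts(2,3) t by (simp add: algebra_simps)
  ultimately show ?thesis
    by (metis distrib_left distrib_right left_diff_distrib right_diff_distrib)
qed

lemma sum_of_two_tripotents:
  "\<exists>s t :: 'a. x = s + t \<and> s * (s * s) = s \<and> t * (t * t) = t"
proof -
  obtain e f where ef: "e ^ 4 = e ^ 2" "f ^ 4 = f ^ 2" "x = e + f"
    using dec unfolding sum_of_commuting_2idem_def by blast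
  have "a * (a * a) = a" if "a ^ 4 = a ^ 2" for a :: 'a
  proof -
    have "a - a ^ 3 = 0"
      by (rule square_zero) (use two_idem_minus_cube(2)[OF that] in \<open>simp add: power2_eq_square\<close>)
    then show ?thesis by (simp add: power3_eq_cube mult.assoc)
  qed
  with ef show ?thesis by blast
qed

lemma commutative: "x * y = y * (x :: 'a)"
  using sum_of_two_tripotents[of x] tripotent_central
  by (metis distrib_left distrib_right)

end
end

section \<open>The prime radical and its quotient\<close>

definition ring_ideal :: "'a::ring_1 set \<Rightarrow> bool" where
  "ring_ideal I \<longleftrightarrow> 0 \<in> I \<and> (\<forall>x\<in>I. \<forall>y\<in>I. x + y \<in> I) \<and> (\<forall>x\<in>I. \<forall>r. r * x \<in> I \<and> x * r \<in> I)"

lemma ring_idealD: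
  assumes "ring_ideal I"
  shows "0 \<in> I" "x \<in> I \<Longrightarrow> y \<in> I \<Longrightarrow> x + y \<in> I" "x \<in> I \<Longrightarrow> r * x \<in> I" "x \<in> I \<Longrightarrow> x * r \<in> I"
    "x \<in> I \<Longrightarrow> - x \<in> I" "x \<in> I \<Longrightarrow> y \<in> I \<Longrightarrow> x - y \<in> I"
proof -
  show *: "0 \<in> I" "x \<in> I \<Longrightarrow> y \<in> I \<Longrightarrow> x + y \<in> I" "x \<in> I \<Longrightarrow> r * x \<in> I" "x \<in> I \<Longrightarrow> x * r \<in> I" for x y r
    using assms by (auto simp: ring_ideal_def)
  show **: "x \<in> I \<Longrightarrow> - x \<in> I" for x
    using *(3)[of x "-1"] by simp
  show "x \<in> I \<Longrightarrow> y \<in> I \<Longrightarrow> x - y \<in> I"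
    using *(2)[of x "- y"] **[of y] by simp
qed

definition semiprime_ideal :: "'a::ring_1 set \<Rightarrow> bool" where
  "semiprime_ideal I \<longleftrightarrow> ring_ideal I \<and> (\<forall>a. (\<forall>r. a * r * a \<in> I) \<longrightarrow> a \<in> I)"

definition prime_radical :: "'a::ring_1 set" where
  "prime_radical = \<Inter> {I. semiprime_ideal I}"

lemma semiprime_prime_radical: "semiprime_ideal prime_radical"
  unfolding prime_radical_def semiprime_ideal_def ring_ideal_def by blast

fun words :: "'a::monoid_mult set \<Rightarrow> nat \<Rightarrow> 'a set" where
  "words F 0 = {1}"
| "words F (Suc m) = (\<lambda>(x, w). x * w) ` (F \<times> words F m)"

lemma finite_words: "finite F \<Longrightarrow> finite (words F m)"
  by (induction m) auto

lemma words_add: "w \<in> words F (k + m) \<Longrightarrow> \<exists>u\<in>words F k. \<exists>v\<in>words F m. w = u * v"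
proof (induction k arbitrary: w)
  case (Suc k)
  then obtain x w' where "x \<in> F" "w' \<in> words F (k + m)" "w = x * w'"
    by auto
  moreover from Suc.IH[OF this(2)] obtain u v where "u \<in> words F k" "v \<in> words F m" "w' = u * v"
    by blast
  ultimately show ?case
    by (intro bexI[of _ "x * u"] bexI[of _ v]) (auto simp: mult.assoc)
qed auto

text \<open>If no length made all words over \<open>F\<close> vanish, Zorn's lemma would give an ideal \<open>P\<close> maximal among those that contain,
for no \<open>m\<close>, all words of length \<open>m\<close>; finiteness of \<open>F\<close> makes this condition pass to unions of chains.
Such a \<open>P\<close> is semiprime: if \<open>a R a\<close> is inside \<open>P\<close> but \<open>a\<close> is not, then the ideal \<open>X\<close> of all \<open>x\<close> with
\<open>x R a\<close> inside \<open>P\<close> and the ideal \<open>Y\<close> of all \<open>y\<close> with \<open>X R y\<close> inside \<open>P\<close> both contain \<open>P\<close> and \<open>a\<close>, so each contains all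
words of some length, while \<open>X Y\<close> lies in \<open>P\<close>. But then \<open>P\<close> contains \<open>F\<close>, a contradiction.\<close>

lemma prime_radical_locally_nilpotent:
  fixes F :: "'a::ring_1 set"
  assumes "finite F" "F \<subseteq> prime_radical"
  shows "\<exists>m. words F m \<subseteq> {0}"
proof (rule ccontr)
  assume non_nil: "\<not> ?thesis"
  define \<C> where "\<C> = {I. ring_ideal I \<and> (\<forall>m. \<not> words F m \<subseteq> I)}"
  have zero: "{0} \<in> \<C>"
    using non_nil by (auto simp: \<C>_def ring_ideal_def)
  have "\<exists>M\<in>\<C>. \<forall>X\<in>\<C>. M \<subseteq> X \<longrightarrow> X = M"
  proof (rule subset_Zorn_nonempty)
    show "\<C> \<noteq> {}" using zero by blast
  next
    fix C assume C: "C \<noteq> {}" "subset.chain \<C> C"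
    then have sub: "C \<subseteq> \<C>" and tot: "\<And>X Y. X \<in> C \<Longrightarrow> Y \<in> C \<Longrightarrow> X \<subseteq> Y \<or> Y \<subseteq> X"
      by (auto simp: subset.chain_def)
    have "ring_ideal (\<Union> C)"
      unfolding ring_ideal_def
    proof (intro conjI ballI allI)
      show "0 \<in> \<Union> C" using C sub by (force simp: \<C>_def ring_ideal_def)
    next
      fix x y assume "x \<in> \<Union> C" "y \<in> \<Union> C"
      then obtain X Y where XY: "X \<in> C" "Y \<in> C" "x \<in> X" "y \<in> Y" by blast
      then obtain Z where Z: "Z \<in> C" "x \<in> Z" "y \<in> Z"
        using tot[of X Y] by blast
      then have "x + y \<in> Z" using sub ring_idealD(2)[of Z] by (auto simp: \<C>_def)
      then show "x + y \<in> \<Union> C" using Z by blast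
    next
      fix x r assume "x \<in> \<Union> C"
      then show "r * x \<in> \<Union> C" "x * r \<in> \<Union> C" using sub by (auto simp: \<C>_def ring_ideal_def)
    qed
    moreover have "\<not> words F m \<subseteq> \<Union> C" for m
    proof
      assume "words F m \<subseteq> \<Union> C"
      (* The finitely many words of length m already lie in one member of the chain. *)
      then obtain X where "X \<in> C" "words F m \<subseteq> X"
        using finite_subset_Union_chain[OF finite_words[OF assms(1)] _ C] by blast
      then show False using sub by (auto simp: \<C>_def)
    qed
    ultimately show "\<Union> C \<in> \<C>" by (simp add: \<C>_def)
  qed
  then obtain P where P: "P \<in> \<C>" and max: "\<And>X. X \<in> \<C> \<Longrightarrow> P \<subseteq> X \<Longrightarrow> X = P"
    by blast
  have idP: "ring_ideal P" using P by (simp add: \<C>_def)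
  note D = ring_idealD[OF idP]
  have grow: "\<exists>m. words F m \<subseteq> X" if "ring_ideal X" "P \<subseteq> X" "a \<in> X" "a \<notin> P" for X a
    using max[of X] that by (auto simp: \<C>_def)
  have "semiprime_ideal P"
    unfolding semiprime_ideal_def
  proof (intro conjI allI impI idP, rule ccontr)
    fix a assume a: "\<forall>r. a * r * a \<in> P" "a \<notin> P"
    define X where "X = {x. \<forall>r. x * r * a \<in> P}"
    have "ring_ideal X"
      unfolding ring_ideal_def
    proof (intro conjI ballI allI)
      fix x r assume "x \<in> X"
      then show "r * x \<in> X" "x * r \<in> X"
        using D(3) unfolding X_def by (auto simp: mult.assoc) (metis mult.assoc)
    qed (use D in \<open>auto simp: X_def distrib_right\<close>)
    moreover have "P \<subseteq> X" unfolding X_def using D by auto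
    ultimately obtain k where k: "words F k \<subseteq> X"
      using grow[of X a] a by (auto simp: X_def)
    define Y where "Y = {y. \<forall>x\<in>X. \<forall>r. x * r * y \<in> P}"
    have "ring_ideal Y"
      unfolding ring_ideal_def
    proof (intro conjI ballI allI)
      fix y r assume "y \<in> Y"
      then show "r * y \<in> Y" "y * r \<in> Y"
        using D(4) unfolding Y_def by (auto simp flip: mult.assoc) (metis mult.assoc)
    qed (use D in \<open>auto simp: Y_def distrib_left\<close>)
    moreover have "P \<subseteq> Y" unfolding Y_def using D by auto
    ultimately obtain m where m: "words F m \<subseteq> Y"
      using grow[of Y a] a by (auto simp: Y_def X_def)
    have "words F (k + m) \<subseteq> P"
    proof
      fix w assume "w \<in> words F (k + m)"
      then obtain u v where uv: "u \<in> X" "v \<in> Y" "w = u * v"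
        using words_add k m by blast
      then have "u * 1 * v \<in> P" unfolding Y_def by blast
      then show "w \<in> P" using uv by simp
    qed
    then show False using P by (auto simp: \<C>_def)
  qed
  then have "F \<subseteq> P" using assms(2) by (auto simp: prime_radical_def)
  then have "words F 1 \<subseteq> P" using D by auto
  then show False using P by (auto simp: \<C>_def simp del: One_nat_def)
qed

lemma one_notin_prime_radical: "(1 :: 'a::ring_1) \<notin> prime_radical"
proof
  assume "(1 :: 'a) \<in> prime_radical"
  then obtain m where "words {1 :: 'a} m \<subseteq> {0}"
    using prime_radical_locally_nilpotent[of "{1 :: 'a}"] by auto
  moreover have "words {1 :: 'a} m = {1}" by (induction m) auto
  ultimately show False by simp
qed

text \<open>As the radical is determined by the ring, the quotient can be formed as a type, and the
results on semiprime rings apply to it in terms of equalities instead of congruences.\<close>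

quotient_type (overloaded) 'a semiprime_quotient = "'a::ring_1" / "\<lambda>x y. x - y \<in> prime_radical"
proof (rule equivpI)
  have I: "ring_ideal (prime_radical :: 'a set)"
    using semiprime_prime_radical by (auto simp: semiprime_ideal_def)
  note D = ring_idealD[OF I]
  show "reflp (\<lambda>x y :: 'a. x - y \<in> prime_radical)" using D by (auto simp: reflp_def)
  show "symp (\<lambda>x y :: 'a. x - y \<in> prime_radical)"
  proof (rule sympI)
    fix x y :: 'a assume "x - y \<in> prime_radical"
    from D(5)[OF this] show "y - x \<in> prime_radical" by simp
  qed
  show "transp (\<lambda>x y :: 'a. x - y \<in> prime_radical)"
  proof (rule transpI)
    fix x y z :: 'a assume "x - y \<in> prime_radical" "y - z \<in> prime_radical"
    from D(2)[OF this] show "x - z \<in> prime_radical" by simp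
  qed
qed

lemmas prime_radicalD = ring_idealD[OF conjunct1[OF semiprime_prime_radical[unfolded semiprime_ideal_def]]]

instantiation semiprime_quotient :: (ring_1) ring_1
begin

lift_definition zero_semiprime_quotient :: "'a semiprime_quotient" is 0 .
lift_definition one_semiprime_quotient :: "'a semiprime_quotient" is 1 .
lift_definition plus_semiprime_quotient :: "'a semiprime_quotient \<Rightarrow> 'a semiprime_quotient \<Rightarrow> 'a semiprime_quotient"
  is "(+)"
  subgoal for a b c d using prime_radicalD(2)[of "a - b" "c - d"] by (simp add: algebra_simps)
  done
lift_definition minus_semiprime_quotient :: "'a semiprime_quotient \<Rightarrow> 'a semiprime_quotient \<Rightarrow> 'a semiprime_quotient"
  is "(-)"
  subgoal for a b c d using prime_radicalD(6)[of "a - b" "c - d"] by (simp add: algebra_simps)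
  done
lift_definition uminus_semiprime_quotient :: "'a semiprime_quotient \<Rightarrow> 'a semiprime_quotient"
  is "uminus"
  subgoal for a b using prime_radicalD(5)[of "a - b"] by simp
  done
lift_definition times_semiprime_quotient :: "'a semiprime_quotient \<Rightarrow> 'a semiprime_quotient \<Rightarrow> 'a semiprime_quotient"
  is "(*)"
  subgoal for a b c d
    using prime_radicalD(2)[OF prime_radicalD(4)[of "a - b" c] prime_radicalD(3)[of "c - d" b]]
    by (simp add: algebra_simps)
  done

instance
proof
  fix a b c :: "'a semiprime_quotient"
  note D = prime_radicalD(1)
  show "a + b + c = a + (b + c)" by transfer (simp add: D add.assoc)
  show "a + b = b + a" by transfer (simp add: D add.commute)
  show "0 + a = a" by transfer (simp add: D)
  show "- a + a = 0" by transfer (simp add: D)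
  show "a - b = a + - b" by transfer (simp add: D)
  show "a * b * c = a * (b * c)" by transfer (simp add: D mult.assoc)
  show "1 * a = a" by transfer (simp add: D)
  show "a * 1 = a" by transfer (simp add: D)
  show "(a + b) * c = a * c + b * c" by transfer (simp add: D distrib_right)
  show "a * (b + c) = a * b + a * c" by transfer (simp add: D distrib_left)
  have "(1 :: 'a semiprime_quotient) \<noteq> 0" by transfer (simp add: one_notin_prime_radical)
  then show "(0 :: 'a semiprime_quotient) \<noteq> 1" by simp
qed

end

lemma semiprime_quotient:
  fixes a :: "'a::ring_1 semiprime_quotient"
  assumes "\<And>r. a * r * a = 0"
  shows "a = 0"
  using assms
proof (transfer, goal_cases)
  case (1 a)
  then show ?case using semiprime_prime_radical by (auto simp: semiprime_ideal_def)
qed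

section \<open>Idempotent splittings and their lifting\<close>

definition in_corner :: "'m::ring_1 \<Rightarrow> 'm \<Rightarrow> bool" where
  "in_corner i x \<longleftrightarrow> i * x = x \<and> x * i = x"

definition orthogonal_idempotents :: "'m::ring_1 \<Rightarrow> 'm \<Rightarrow> 'm \<Rightarrow> bool" where
  "orthogonal_idempotents i p q \<longleftrightarrow>
     in_corner i p \<and> in_corner i q \<and> p * p = p \<and> q * q = q \<and> p * q = 0 \<and> q * p = 0"

text \<open>Differences of orthogonal idempotents are used instead of arbitrary tripotents because they lift modulo
nil ideals without any assumption on 2.\<close>

definition splits :: "'m::ring_1 \<Rightarrow> 'm \<Rightarrow> bool" where
  "splits i a \<longleftrightarrow> (\<exists>p q p' q' c k. orthogonal_idempotents i p q \<and> orthogonal_idempotents i p' q' \<and>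
     in_corner i c \<and> c ^ k = 0 \<and> a = (p - q) + (p' - q') + c)"

lemma in_corner_mult: "in_corner i x \<Longrightarrow> in_corner i y \<Longrightarrow> in_corner i (x * y)"
  unfolding in_corner_def by (metis mult.assoc)

lemma in_corner_orth:
  assumes "in_corner i x" "in_corner j y" "i * j = 0"
  shows "x * y = 0"
  by (metis assms in_corner_def mult.assoc mult_zero_left mult_zero_right)

lemma orthogonal_idempotents_add:
  assumes "orthogonal_idempotents i p q" "orthogonal_idempotents j r s" "i * j = 0" "j * i = 0"
  shows "orthogonal_idempotents (i + j) (p + r) (q + s)"
proof -
  have c: "in_corner i p" "in_corner i q" "in_corner j r" "in_corner j s"
    using assms by (auto simp: orthogonal_idempotents_def)
  have 0: "p * r = 0" "r * p = 0" "p * s = 0" "s * p = 0" "q * r = 0" "r * q = 0" "q * s = 0" "s * q = 0"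
    using c assms(3,4) in_corner_orth by blast+
  have "i * r = 0" "r * i = 0" "i * s = 0" "s * i = 0" "j * p = 0" "p * j = 0" "j * q = 0" "q * j = 0"
    using c assms(3,4) by (metis in_corner_def mult.assoc mult_zero_left mult_zero_right)+
  then show ?thesis
    using assms(1,2) 0 by (simp add: orthogonal_idempotents_def in_corner_def distrib_left distrib_right)
qed

lemma splits_add:
  assumes "splits i a" "splits j b" "i * j = 0" "j * i = 0"
  shows "splits (i + j) (a + b)"
proof -
  obtain p q p' q' c k where 1: "orthogonal_idempotents i p q" "orthogonal_idempotents i p' q'"
    "in_corner i c" "c ^ k = 0" "a = (p - q) + (p' - q') + c"
    using assms(1) unfolding splits_def by blast
  obtain r s r' s' d l where 2: "orthogonal_idempotents j r s" "orthogonal_idempotents j r' s'"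
    "in_corner j d" "d ^ l = 0" "b = (r - s) + (r' - s') + d"
    using assms(2) unfolding splits_def by blast
  have cd: "c * d = 0" "d * c = 0"
    using in_corner_orth 1 2 assms(3,4) by blast+
  have "(c + d) ^ Suc m = c ^ Suc m + d ^ Suc m" for m
  proof (induction m)
    case (Suc m)
    have "(c + d) ^ Suc (Suc m) = (c + d) * (c ^ Suc m + d ^ Suc m)"
      by (subst power_Suc) (simp only: Suc)
    then show ?case
      using cd by (simp add: distrib_left distrib_right flip: mult.assoc)
  qed simp
  from this[of "k + l"] have "(c + d) ^ Suc (k + l) = 0"
    using 1(4) 2(4) by (simp add: power_add)
  moreover have "i * d = 0" "d * i = 0" "j * c = 0" "c * j = 0"
    using 1(3) 2(3) assms(3,4) by (metis in_corner_def mult.assoc mult_zero_left mult_zero_right)+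
  then have "in_corner (i + j) (c + d)"
    using 1(3) 2(3) by (simp add: in_corner_def distrib_left distrib_right)
  moreover have "a + b = ((p + r) - (q + s)) + ((p' + r') - (q' + s')) + (c + d)"
    by (simp add: 1(5) 2(5) algebra_simps)
  ultimately show ?thesis
    unfolding splits_def
    using orthogonal_idempotents_add[OF 1(1) 2(1) assms(3,4)]
      orthogonal_idempotents_add[OF 1(2) 2(2) assms(3,4)] by blast
qed

lemma splits_conj:
  assumes u: "in_corner i u" and v: "in_corner i v" and a: "in_corner i a"
    and uv: "u * v = i" "v * u = i" and s: "splits i (v * a * u)"
  shows "splits i a"
proof -
  obtain p q p' q' c k where 1: "orthogonal_idempotents i p q" "orthogonal_idempotents i p' q'"
    "in_corner i c" "c ^ k = 0" "v * a * u = (p - q) + (p' - q') + c"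
    using s unfolding splits_def by blast
  define h where "h x = u * x * v" for x
  have hh: "h x * h y = h (x * y)" if "in_corner i x" for x y
  proof -
    have "h x * h y = u * (x * (v * u)) * y * v" by (simp add: h_def mult.assoc)
    also have "x * (v * u) = x" using that uv by (simp add: in_corner_def)
    finally show ?thesis by (simp add: h_def mult.assoc)
  qed
  have hc: "in_corner i (h x)" for x
    using u v by (simp add: h_def in_corner_def mult.assoc) (simp flip: mult.assoc)
  have h0: "h 0 = 0" by (simp add: h_def)
  have ho: "orthogonal_idempotents i (h x) (h y)" if "orthogonal_idempotents i x y" for x y
    using that by (simp add: orthogonal_idempotents_def hc hh h0)
  have "h c ^ Suc m = h (c ^ Suc m)" for m
  proof (induction m)
    case (Suc m)
    have "h c ^ Suc (Suc m) = h c * h (c ^ Suc m)"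
      by (subst power_Suc) (simp only: Suc)
    then show ?case by (simp only: hh[OF 1(3)] power_Suc)
  qed simp
  then have "h c ^ Suc k = 0" using 1(4) by (simp add: h0)
  moreover have "a = (h p - h q) + (h p' - h q') + h c"
  proof -
    have "a = h (v * a * u)"
      using a uv by (simp add: h_def in_corner_def mult.assoc) (simp flip: mult.assoc)
    also have "\<dots> = (h p - h q) + (h p' - h q') + h c"
      by (simp only: 1(5)) (simp add: h_def algebra_simps)
    finally show ?thesis .
  qed
  ultimately show ?thesis
    unfolding splits_def using ho[OF 1(1)] ho[OF 1(2)] hc by blast
qed

text \<open>The iteration \<open>x \<mapsto> 3 x\<^sup>2 - 2 x\<^sup>3\<close>, in the form \<open>x + g (1 - 2 x)\<close> with \<open>g = x\<^sup>2 - x\<close>, replaces the defect \<open>g\<close> by a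
multiple of \<open>g\<^sup>2\<close>.\<close>

lemma idempotent_lift_step:
  fixes x :: "'m::ring_1"
  defines "g \<equiv> x * x - x"
  defines "y \<equiv> x + g * (1 - x - x)"
  shows "y * y - y = (g * g) * (g + g + g + g - 1 - 1 - 1)"
  unfolding y_def g_def by (simp add: algebra_simps)

locale ring_1_hom =
  fixes \<phi> :: "'m::ring_1 \<Rightarrow> 'n::ring_1"
  assumes hom_add: "\<phi> (x + y) = \<phi> x + \<phi> y"
    and hom_mult: "\<phi> (x * y) = \<phi> x * \<phi> y"
    and hom_one: "\<phi> 1 = 1"
begin

lemma hom_zero: "\<phi> 0 = 0"
  using hom_add[of 0 0] by simp

lemma hom_diff: "\<phi> (x - y) = \<phi> x - \<phi> y"
  using hom_add[of "x - y" y] by (simp add: algebra_simps)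

lemma hom_power: "\<phi> (x ^ k) = \<phi> x ^ k"
  by (induction k) (simp_all add: hom_one hom_mult)

text \<open>The lift is a multiple of \<open>x\<close> by a polynomial in \<open>x\<close>; the last two clauses record this in the form in which it keeps
the lift inside a corner and orthogonal to a given idempotent.\<close>

lemma lift_idempotent:
  assumes "\<phi> x * \<phi> x = \<phi> x" "(x * x - x) ^ (2 ^ m) = 0"
  shows "\<exists>e. e * e = e \<and> \<phi> e = \<phi> x \<and> (\<forall>y. y * x = 0 \<longrightarrow> y * e = 0) \<and> (\<forall>y. x * y = 0 \<longrightarrow> e * y = 0)"
  using assms
proof (induction m arbitrary: x)
  case 0
  then show ?case by (intro exI[of _ x]) simp
next
  case (Suc m)
  define g where "g = x * x - x"
  define x' where "x' = x + g * (1 - x - x)"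
  define h where "h = g + g + g + g - 1 - 1 - 1"
  have "\<phi> g = 0"
    using Suc.prems(1) by (simp add: g_def hom_diff hom_mult)
  then have \<phi>: "\<phi> x' = \<phi> x"
    by (simp add: x'_def hom_add hom_mult)
  have "(g * g) * h = h * (g * g)"
    by (simp add: h_def algebra_simps numeral_commute[of g] numeral_mult_comm[of g])
  then have "(x' * x' - x') ^ (2 ^ m) = (g * g) ^ (2 ^ m) * h ^ (2 ^ m)"
    using idempotent_lift_step[of x] power_mult_distrib_commuting[of "g * g" h "2 ^ m"]
    by (simp add: x'_def g_def h_def)
  also have "(g * g) ^ (2 ^ m) = g ^ (2 ^ Suc m)"
    by (simp add: power_mult_distrib_commuting mult_2 power_add)
  finally have "(x' * x' - x') ^ (2 ^ m) = 0"
    using Suc.prems(2) by (simp add: g_def)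
  then obtain e where e: "e * e = e" "\<phi> e = \<phi> x"
    "\<And>y. y * x' = 0 \<Longrightarrow> y * e = 0" "\<And>y. x' * y = 0 \<Longrightarrow> e * y = 0"
    using Suc.IH[of x'] Suc.prems(1) \<phi> by auto
  have "y * x' = 0" if "y * x = 0" for y
  proof -
    have "y * x' = y * x + (y * x) * (x - 1) * (1 - x - x)"
      by (simp add: x'_def g_def algebra_simps)
    then show ?thesis using that by simp
  qed
  moreover have "x' * y = 0" if "x * y = 0" for y
  proof -
    have "x' * y = x * y + (x - 1) * (1 - x - x) * (x * y)"
      by (simp add: x'_def g_def algebra_simps)
    then show ?thesis using that by simp
  qed
  ultimately show ?case using e by blast
qed

context
  fixes i :: 'm
  assumes idem: "i * i = i"
    and nil_kernel: "\<And>x. in_corner i x \<Longrightarrow> \<phi> x = 0 \<Longrightarrow> \<exists>k. x ^ k = 0"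
    and surj: "\<And>y. in_corner (\<phi> i) y \<Longrightarrow> \<exists>x. in_corner i x \<and> \<phi> x = y"
begin

lemma lift_corner_idempotent:
  assumes "in_corner i x" "\<phi> x * \<phi> x = \<phi> x"
  shows "\<exists>e. in_corner i e \<and> e * e = e \<and> \<phi> e = \<phi> x \<and>
    (\<forall>y. y * x = 0 \<longrightarrow> y * e = 0) \<and> (\<forall>y. x * y = 0 \<longrightarrow> e * y = 0)"
proof -
  have "in_corner i (x * x - x)"
    using assms(1) by (simp add: in_corner_def right_diff_distrib left_diff_distrib mult.assoc)
      (simp flip: mult.assoc)
  moreover have "\<phi> (x * x - x) = 0"
    using assms(2) by (simp add: hom_diff hom_mult)
  ultimately obtain k where "(x * x - x) ^ k = 0"
    using nil_kernel by blast
  moreover have "k \<le> 2 ^ k" by (simp add: less_imp_le)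
  ultimately have "(x * x - x) ^ (2 ^ k) = 0"
    by (metis le_add_diff_inverse mult_zero_left power_add)
  from lift_idempotent[OF assms(2) this] obtain e where
    e: "e * e = e" "\<phi> e = \<phi> x" "\<And>y. y * x = 0 \<Longrightarrow> y * e = 0" "\<And>y. x * y = 0 \<Longrightarrow> e * y = 0"
    by blast
  have "in_corner i e"
    using e(3)[of "1 - i"] e(4)[of "1 - i"] assms(1)
    by (simp add: in_corner_def left_diff_distrib right_diff_distrib)
  with e show ?thesis by blast
qed

text \<open>After lifting the first idempotent to \<open>e\<close>, a preimage of the second one is compressed by \<open>1 - e\<close>, which
changes it only within the kernel; its lift then stays orthogonal to \<open>e\<close>.\<close>

lemma lift_orthogonal_idempotents:
  assumes "orthogonal_idempotents (\<phi> i) p q"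
  shows "\<exists>p' q'. orthogonal_idempotents i p' q' \<and> \<phi> p' = p \<and> \<phi> q' = q"
proof -
  have pq: "in_corner (\<phi> i) p" "in_corner (\<phi> i) q" "p * p = p" "q * q = q" "p * q = 0" "q * p = 0"
    using assms by (auto simp: orthogonal_idempotents_def)
  obtain x where x: "in_corner i x" "\<phi> x = p" using surj pq(1) by blast
  obtain y where y: "in_corner i y" "\<phi> y = q" using surj pq(2) by blast
  obtain e where e: "in_corner i e" "e * e = e" "\<phi> e = p"
    using lift_corner_idempotent[OF x(1)] x(2) pq(3) by auto
  define z where "z = (1 - e) * y * (1 - e)"
  have z: "in_corner i z"
  proof -
    have "i * (e * w) = e * w" "i * (y * w) = y * w" for w
      using e(1) y(1) by (simp_all add: in_corner_def flip: mult.assoc)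
    then show ?thesis
      using e(1) y(1) by (simp add: z_def in_corner_def left_diff_distrib right_diff_distrib mult.assoc)
  qed
  have \<phi>z: "\<phi> z = q"
    by (simp add: z_def hom_mult hom_diff hom_one e y left_diff_distrib right_diff_distrib pq mult.assoc)
  obtain f where f: "in_corner i f" "f * f = f" "\<phi> f = q"
    "\<And>w. w * z = 0 \<Longrightarrow> w * f = 0" "\<And>w. z * w = 0 \<Longrightarrow> f * w = 0"
    using lift_corner_idempotent[OF z] \<phi>z pq(4) by auto
  have "e * z = 0" "z * e = 0"
    using e(2) by (simp_all add: z_def left_diff_distrib right_diff_distrib mult.assoc)
      (simp flip: mult.assoc)
  with e f show ?thesis
    unfolding orthogonal_idempotents_def by blast
qed

lemma lift_splits:
  assumes a: "in_corner i a" and "splits (\<phi> i) (\<phi> a)"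
  shows "splits i a"
proof -
  obtain p q p' q' c k where 1: "orthogonal_idempotents (\<phi> i) p q" "orthogonal_idempotents (\<phi> i) p' q'"
    "in_corner (\<phi> i) c" "c ^ k = 0" "\<phi> a = (p - q) + (p' - q') + c"
    using assms(2) unfolding splits_def by blast
  obtain r s where rs: "orthogonal_idempotents i r s" "\<phi> r = p" "\<phi> s = q"
    using lift_orthogonal_idempotents[OF 1(1)] by blast
  obtain r' s' where rs': "orthogonal_idempotents i r' s'" "\<phi> r' = p'" "\<phi> s' = q'"
    using lift_orthogonal_idempotents[OF 1(2)] by blast
  define d where "d = a - (r - s) - (r' - s')"
  have d: "in_corner i d"
    using a rs(1) rs'(1)
    by (simp add: d_def in_corner_def orthogonal_idempotents_def left_diff_distrib right_diff_distrib)
  have "\<phi> (d ^ Suc k) = 0"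
    using 1(4,5) by (simp add: hom_power hom_mult d_def hom_diff rs rs')
  moreover have "in_corner i (d ^ Suc k)"
    using d unfolding in_corner_def by (metis mult.assoc power_Suc power_Suc2)
  ultimately obtain l where "(d ^ Suc k) ^ l = 0"
    using nil_kernel by blast
  then have "d ^ (Suc k * l) = 0" by (simp only: power_mult)
  moreover have "a = (r - s) + (r' - s') + d" by (simp add: d_def)
  ultimately show ?thesis
    unfolding splits_def using rs(1) rs'(1) d by blast
qed

end
end

lemma tripotent_diff:
  assumes "orthogonal_idempotents i p q"
  shows "(p - q) * (p - q) * (p - q) = p - q"
  using assms by (simp add: orthogonal_idempotents_def left_diff_distrib right_diff_distrib distrib_right)

section \<open>Row-finite matrices\<close>

text \<open>Infinite matrices with finitely supported rows form a unital ring, whatever the size of the matrices of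
interest; those of size \<open>n\<close> are the corner cut out by a diagonal idempotent.\<close>

typedef (overloaded) 'a rfmat = "{f :: nat \<Rightarrow> nat \<Rightarrow> 'a::zero. \<forall>i. finite {j. f i j \<noteq> 0}}"
  morphisms ent Abs_rfmat
  by (rule exI[of _ "\<lambda>_ _. 0"]) simp

setup_lifting type_definition_rfmat

lemma finite_row: "finite {j. ent X i j \<noteq> 0}"
  using ent[of X] by simp

lemma rfmat_eqI: "(\<And>i j. ent X i j = ent Y i j) \<Longrightarrow> X = Y"
  by (simp add: ent_inject[symmetric] fun_eq_iff)

instantiation rfmat :: (ring_1) ring_1
begin

lift_definition zero_rfmat :: "'a rfmat" is "\<lambda>_ _. 0" by simp

lift_definition one_rfmat :: "'a rfmat" is "\<lambda>i j. if i = j then 1 else 0" by simp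

lift_definition plus_rfmat :: "'a rfmat \<Rightarrow> 'a rfmat \<Rightarrow> 'a rfmat" is "\<lambda>f g i j. f i j + g i j"
  subgoal premises prems for f g i
    by (rule finite_subset[of _ "{j. f i j \<noteq> 0} \<union> {j. g i j \<noteq> 0}"]) (use prems in auto)
  done

lift_definition minus_rfmat :: "'a rfmat \<Rightarrow> 'a rfmat \<Rightarrow> 'a rfmat" is "\<lambda>f g i j. f i j - g i j"
  subgoal premises prems for f g i
    by (rule finite_subset[of _ "{j. f i j \<noteq> 0} \<union> {j. g i j \<noteq> 0}"]) (use prems in auto)
  done

lift_definition uminus_rfmat :: "'a rfmat \<Rightarrow> 'a rfmat" is "\<lambda>f i j. - f i j" by simp

lift_definition times_rfmat :: "'a rfmat \<Rightarrow> 'a rfmat \<Rightarrow> 'a rfmat"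
  is "\<lambda>f g i j. \<Sum>k | f i k \<noteq> 0. f i k * g k j"
  subgoal premises prems for f g i
  proof (rule finite_subset)
    show "{j. (\<Sum>k | f i k \<noteq> 0. f i k * g k j) \<noteq> 0} \<subseteq> (\<Union>k\<in>{k. f i k \<noteq> 0}. {j. g k j \<noteq> 0})"
    proof (rule subsetI, rule ccontr)
      fix j assume j: "j \<in> {j. (\<Sum>k | f i k \<noteq> 0. f i k * g k j) \<noteq> 0}"
        and "j \<notin> (\<Union>k\<in>{k. f i k \<noteq> 0}. {j. g k j \<noteq> 0})"
      then have "f i k * g k j = 0" for k by (cases "f i k = 0") auto
      then show False using j by simp
    qed
    show "finite (\<Union>k\<in>{k. f i k \<noteq> 0}. {j. g k j \<noteq> 0})" using prems by simp
  qed
  done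

lemma ent_mult:
  assumes "finite S" "\<And>k. ent X i k \<noteq> 0 \<Longrightarrow> k \<in> S"
  shows "ent (X * Y) i j = (\<Sum>k\<in>S. ent X i k * ent Y k j)"
  unfolding times_rfmat.rep_eq
  by (rule sum.mono_neutral_left) (use assms in auto)

lemma rfmat_mult_assoc: "(X * Y) * Z = X * (Y * Z)" for X Y Z :: "'a rfmat"
proof (rule rfmat_eqI)
  fix i j
  define S where "S = {k. ent X i k \<noteq> 0}"
  define T where "T = (\<Union>k\<in>S. {l. ent Y k l \<noteq> 0})"
  have S: "finite S" "\<And>k. ent X i k \<noteq> 0 \<Longrightarrow> k \<in> S"
    by (auto simp: S_def finite_row)
  have T: "finite T" using S by (auto simp: T_def finite_row)
  have XY: "ent (X * Y) i l = (\<Sum>k\<in>S. ent X i k * ent Y k l)" for l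
    using S by (rule ent_mult)
  have "l \<in> T" if "ent (X * Y) i l \<noteq> 0" for l
  proof (rule ccontr)
    assume "l \<notin> T"
    then have "\<And>k. k \<in> S \<Longrightarrow> ent Y k l = 0" by (auto simp: T_def)
    then show False using that unfolding XY by simp
  qed
  then have "ent ((X * Y) * Z) i j = (\<Sum>l\<in>T. ent (X * Y) i l * ent Z l j)"
    using T by (intro ent_mult)
  also have "\<dots> = (\<Sum>k\<in>S. \<Sum>l\<in>T. ent X i k * (ent Y k l * ent Z l j))"
    unfolding XY sum_distrib_right by (subst sum.swap) (simp add: mult.assoc)
  also have "\<dots> = (\<Sum>k\<in>S. ent X i k * ent (Y * Z) k j)"
  proof (rule sum.cong[OF refl])
    fix k assume "k \<in> S"
    then have "ent (Y * Z) k j = (\<Sum>l\<in>T. ent Y k l * ent Z l j)"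
      by (intro ent_mult T) (auto simp: T_def)
    then show "(\<Sum>l\<in>T. ent X i k * (ent Y k l * ent Z l j)) = ent X i k * ent (Y * Z) k j"
      by (simp add: sum_distrib_left)
  qed
  also have "\<dots> = ent (X * (Y * Z)) i j"
    using S by (rule ent_mult[symmetric])
  finally show "ent ((X * Y) * Z) i j = ent (X * (Y * Z)) i j" .
qed

lemmas ent_simps = zero_rfmat.rep_eq one_rfmat.rep_eq plus_rfmat.rep_eq minus_rfmat.rep_eq
  uminus_rfmat.rep_eq

instance
proof
  fix A B C :: "'a rfmat"
  note rfmat_eqI[intro]
  show "A + B + C = A + (B + C)" by (auto simp: ent_simps add.assoc)
  show "A + B = B + A" by (auto simp: ent_simps add.commute)
  show "0 + A = A" "- A + A = 0" "A - B = A + - B" by (auto simp: ent_simps)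
  show "A * B * C = A * (B * C)" by (rule rfmat_mult_assoc)
  show "1 * A = A"
  proof
    fix i j
    show "ent (1 * A) i j = ent A i j"
      by (subst ent_mult[of "{i}"]) (auto simp: ent_simps split: if_splits)
  qed
  show "A * 1 = A"
  proof
    fix i j
    show "ent (A * 1) i j = ent A i j"
      by (subst ent_mult[of "insert j {k. ent A i k \<noteq> 0}"])
        (auto simp: ent_simps finite_row if_distrib[of "\<lambda>z. _ * z"] cong: if_cong)
  qed
  show "(A + B) * C = A * C + B * C"
  proof
    fix i j
    let ?S = "{k. ent A i k \<noteq> 0} \<union> {k. ent B i k \<noteq> 0}"
    have "ent (X * C) i j = (\<Sum>k\<in>?S. ent X i k * ent C k j)" if "X \<in> {A, B, A + B}" for X
      by (rule ent_mult) (use that in \<open>auto simp: finite_row ent_simps\<close>)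
    then show "ent ((A + B) * C) i j = ent (A * C + B * C) i j"
      by (simp add: ent_simps distrib_right sum.distrib)
  qed
  show "A * (B + C) = A * B + A * C"
    by (auto simp: ent_simps times_rfmat.rep_eq distrib_left sum.distrib)
  have "ent (0 :: 'a rfmat) 0 0 \<noteq> ent 1 0 0" by (simp add: ent_simps)
  then show "(0 :: 'a rfmat) \<noteq> 1" by metis
qed

end

definition mk_rfmat :: "nat \<Rightarrow> (nat \<Rightarrow> nat \<Rightarrow> 'a) \<Rightarrow> 'a::zero rfmat" where
  "mk_rfmat n f = Abs_rfmat (\<lambda>i j. if i < n \<and> j < n then f i j else 0)"

lemma ent_mk_rfmat: "ent (mk_rfmat n f) i j = (if i < n \<and> j < n then f i j else 0)"
proof -
  have "finite {j. (if i < n \<and> j < n then f i j else 0) \<noteq> 0}" for i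
    by (rule finite_subset[of _ "{..<n}"]) auto
  then show ?thesis unfolding mk_rfmat_def by (subst Abs_rfmat_inverse) auto
qed

text \<open>For an idempotent \<open>e\<close> this is the unit of the matrices of size \<open>n\<close> over the corner of \<open>e\<close>.\<close>

definition diag_rfmat :: "nat \<Rightarrow> 'a \<Rightarrow> 'a::zero rfmat" where
  "diag_rfmat n e = mk_rfmat n (\<lambda>i j. if i = j then e else 0)"

lemma ent_diag: "ent (diag_rfmat n e) i j = (if i = j \<and> i < n then e else 0)"
  by (simp add: diag_rfmat_def ent_mk_rfmat)

lemma ent_diag_column: "ent (diag_rfmat n e) k j = (if k = j then if j < n then e else 0 else 0)"
  by (simp add: ent_diag)

lemma ent_diag_mult: "ent (diag_rfmat n e * X) i j = (if i < n then e * ent X i j else 0)"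
  by (subst ent_mult[of "{i}"]) (auto simp: ent_diag split: if_splits)

lemma ent_mult_diag: "ent (X * diag_rfmat n e) i j = (if j < n then ent X i j * e else 0)"
  by (subst ent_mult[of "insert j {k. ent X i k \<noteq> 0}"])
    (auto simp: ent_diag_column finite_row if_distrib[of "\<lambda>z. _ * z"] cong: if_cong)

definition supp_less :: "nat \<Rightarrow> 'a::zero rfmat \<Rightarrow> bool" where
  "supp_less n X \<longleftrightarrow> (\<forall>i j. ent X i j \<noteq> 0 \<longrightarrow> i < n \<and> j < n)"

lemma ent_mult_supp:
  assumes "supp_less n X"
  shows "ent (X * Y) i j = (\<Sum>k<n. ent X i k * ent Y k j)"
  by (rule ent_mult) (use assms in \<open>auto simp: supp_less_def\<close>)

lemma in_corner_diag_iff: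
  "in_corner (diag_rfmat n e) X \<longleftrightarrow>
     supp_less n X \<and> (\<forall>i j. e * ent X i j = ent X i j \<and> ent X i j * e = ent X i j)"
proof
  assume "in_corner (diag_rfmat n e) X"
  then have X: "diag_rfmat n e * X = X" "X * diag_rfmat n e = X" by (auto simp: in_corner_def)
  have *: "ent X i j = (if i < n then e * ent X i j else 0)"
    "ent X i j = (if j < n then ent X i j * e else 0)" for i j
    using ent_diag_mult[of n e X] ent_mult_diag[of X n e] unfolding X by auto
  then show "supp_less n X \<and> (\<forall>i j. e * ent X i j = ent X i j \<and> ent X i j * e = ent X i j)"
    unfolding supp_less_def by (metis mult_zero_left mult_zero_right)
next
  assume "supp_less n X \<and> (\<forall>i j. e * ent X i j = ent X i j \<and> ent X i j * e = ent X i j)"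
  then show "in_corner (diag_rfmat n e) X"
    unfolding in_corner_def supp_less_def
    by (intro conjI rfmat_eqI) (simp_all add: ent_diag_mult ent_mult_diag, blast+)
qed

lemma abs_quotient_zero_iff: "abs_semiprime_quotient x = 0 \<longleftrightarrow> x \<in> prime_radical"
  using semiprime_quotient.abs_eq_iff[of x 0] by (simp add: zero_semiprime_quotient_def)

lift_definition rfmat_quotient :: "'a::ring_1 rfmat \<Rightarrow> 'a semiprime_quotient rfmat"
  is "\<lambda>f i j. abs_semiprime_quotient (f i j)"
  subgoal premises prems for f i
    by (rule finite_subset[OF _ prems[of i]])
      (auto simp: abs_quotient_zero_iff prime_radicalD(1))
  done

lemma abs_quotient_hom: "ring_1_hom (abs_semiprime_quotient :: 'a::ring_1 \<Rightarrow> _)"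
  by standard (simp_all add: plus_semiprime_quotient.abs_eq times_semiprime_quotient.abs_eq
      one_semiprime_quotient_def)

lemma rfmat_quotient_hom: "ring_1_hom (rfmat_quotient :: 'a::ring_1 rfmat \<Rightarrow> _)"
proof -
  interpret q: ring_1_hom "abs_semiprime_quotient :: 'a \<Rightarrow> _" by (rule abs_quotient_hom)
  have sum: "abs_semiprime_quotient (sum f S) = (\<Sum>x\<in>S. abs_semiprime_quotient (f x :: 'a))" for f S
    by (induction S rule: infinite_finite_induct) (simp_all add: q.hom_zero q.hom_add)
  show ?thesis
  proof
    fix X Y :: "'a rfmat"
    show "rfmat_quotient (X + Y) = rfmat_quotient X + rfmat_quotient Y"
      by (rule rfmat_eqI) (simp add: rfmat_quotient.rep_eq ent_simps q.hom_add)
    show "rfmat_quotient 1 = (1 :: 'a semiprime_quotient rfmat)"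
      by (rule rfmat_eqI) (simp add: rfmat_quotient.rep_eq ent_simps q.hom_one q.hom_zero)
    show "rfmat_quotient (X * Y) = rfmat_quotient X * rfmat_quotient Y"
    proof (rule rfmat_eqI)
      fix i j
      let ?S = "{k. ent X i k \<noteq> 0}"
      have "ent (rfmat_quotient X * rfmat_quotient Y) i j =
          (\<Sum>k\<in>?S. ent (rfmat_quotient X) i k * ent (rfmat_quotient Y) k j)"
        by (rule ent_mult) (auto simp: finite_row rfmat_quotient.rep_eq q.hom_zero)
      then show "ent (rfmat_quotient (X * Y)) i j = ent (rfmat_quotient X * rfmat_quotient Y) i j"
        by (simp add: rfmat_quotient.rep_eq times_rfmat.rep_eq sum q.hom_mult)
    qed
  qed
qed

text \<open>Each entry of \<open>X\<^sup>m\<close> is a sum of products of \<open>m\<close> entries of \<open>X\<close>, so local nilpotence of the radical applies. The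
induction follows the partial products: entries of \<open>X\<^sup>t\<close> annihilate the words of length \<open>m - t\<close>.\<close>

lemma rfmat_quotient_kernel_nil:
  fixes X :: "'a::ring_1 rfmat"
  assumes "supp_less n X" "rfmat_quotient X = 0"
  shows "\<exists>k. X ^ k = 0"
proof -
  define F where "F = (\<lambda>(i, j). ent X i j) ` ({..<n} \<times> {..<n})"
  have "ent X i j \<in> prime_radical" for i j
    using arg_cong[OF assms(2), of "\<lambda>Y. ent Y i j"]
    by (simp add: rfmat_quotient.rep_eq ent_simps abs_quotient_zero_iff)
  then have "finite F" "F \<subseteq> prime_radical" by (auto simp: F_def)
  then obtain m where m: "words F m \<subseteq> {0}"
    using prime_radical_locally_nilpotent by blast
  have "t \<le> m \<longrightarrow> (\<forall>i j. \<forall>w\<in>words F (m - t). ent (X ^ t) i j * w = 0)" for t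
  proof (induction t)
    case 0
    show ?case using m by auto
  next
    case (Suc t)
    show ?case
    proof (intro impI allI ballI)
      fix i j w assume t: "Suc t \<le> m" and w: "w \<in> words F (m - Suc t)"
      have 0: "ent (X ^ t) i k * (ent X k j * w) = 0" for k
      proof (cases "ent X k j = 0")
        case False
        then have "ent X k j \<in> F" using assms(1) by (auto simp: supp_less_def F_def)
        then have "ent X k j * w \<in> words F (Suc (m - Suc t))" using w by force
        then show ?thesis using Suc t by (simp add: Suc_diff_Suc)
      qed simp
      have "ent (X ^ Suc t) i j * w =
          (\<Sum>k | ent (X ^ t) i k \<noteq> 0. ent (X ^ t) i k * (ent X k j * w))"
        unfolding power_Suc2 times_rfmat.rep_eq by (simp add: sum_distrib_right mult.assoc)
      then show "ent (X ^ Suc t) i j * w = 0" by (simp only: 0 sum.neutral_const)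
    qed
  qed
  from this[of m] have "X ^ m = 0" by (auto intro!: rfmat_eqI simp: ent_simps)
  then show ?thesis ..
qed

lemma rfmat_quotient_surj:
  fixes Y :: "'a::ring_1 semiprime_quotient rfmat"
  assumes "supp_less n Y"
  shows "\<exists>X. supp_less n X \<and> rfmat_quotient X = Y"
proof -
  have "\<exists>x :: 'a. abs_semiprime_quotient x = y" for y
    by (induction y rule: semiprime_quotient.abs_induct) blast
  then obtain r where r: "\<And>y. abs_semiprime_quotient (r y :: 'a) = y" by metis
  let ?X = "mk_rfmat n (\<lambda>i j. r (ent Y i j))"
  have "rfmat_quotient ?X = Y"
    using assms
    by (auto intro!: rfmat_eqI simp: rfmat_quotient.rep_eq ent_mk_rfmat r supp_less_def
        abs_quotient_zero_iff prime_radicalD(1))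
      (metis zero_semiprime_quotient_def)+
  then show ?thesis
    by (intro exI[of _ ?X]) (auto simp: supp_less_def ent_mk_rfmat)
qed

lemma splits_from_quotient:
  fixes A :: "'a::ring_1 rfmat"
  assumes "supp_less n A" "splits (diag_rfmat n 1) (rfmat_quotient A)"
  shows "splits (diag_rfmat n 1) A"
proof -
  interpret ring_1_hom "rfmat_quotient :: 'a rfmat \<Rightarrow> _" by (rule rfmat_quotient_hom)
  have I: "rfmat_quotient (diag_rfmat n 1 :: 'a rfmat) = diag_rfmat n 1"
    by (rule rfmat_eqI)
      (simp add: rfmat_quotient.rep_eq ent_diag abs_quotient_zero_iff prime_radicalD(1)
        ring_1_hom.hom_one[OF abs_quotient_hom])
  have c: "in_corner (diag_rfmat n 1) X \<longleftrightarrow> supp_less n X" for X :: "'b::ring_1 rfmat"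
    by (simp add: in_corner_diag_iff)
  show ?thesis
  proof (rule lift_splits)
    show "diag_rfmat n 1 * diag_rfmat n 1 = (diag_rfmat n 1 :: 'a rfmat)"
      by (rule rfmat_eqI) (simp add: ent_diag_mult ent_diag)
  qed (use assms rfmat_quotient_kernel_nil rfmat_quotient_surj in \<open>auto simp: c I\<close>)
qed

section \<open>Matrices over a field with at most five elements\<close>

lemma nilpotent_of_rank:
  fixes X :: "'a::ring_1 rfmat" and \<rho> :: "nat \<Rightarrow> nat"
  assumes "\<And>i j. ent X i j \<noteq> 0 \<Longrightarrow> \<rho> i < \<rho> j \<and> \<rho> j < b"
  shows "X ^ Suc b = 0"
proof -
  have step: "ent (X ^ t) i j \<noteq> 0 \<Longrightarrow> \<rho> i + t \<le> \<rho> j" for t i j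
  proof (induction t arbitrary: j)
    case 0
    then show ?case by (auto simp: ent_simps split: if_splits)
  next
    case (Suc t)
    have "ent (X ^ Suc t) i j = (\<Sum>k | ent (X ^ t) i k \<noteq> 0. ent (X ^ t) i k * ent X k j)"
      unfolding power_Suc2 times_rfmat.rep_eq ..
    with Suc.prems have "(\<Sum>k | ent (X ^ t) i k \<noteq> 0. ent (X ^ t) i k * ent X k j) \<noteq> 0"
      by simp
    then obtain k where "k \<in> {k. ent (X ^ t) i k \<noteq> 0}" "ent (X ^ t) i k * ent X k j \<noteq> 0"
      by (rule sum.not_neutral_contains_not_neutral)
    then have "ent (X ^ t) i k \<noteq> 0" "ent X k j \<noteq> 0" by auto
    then show ?case using Suc.IH[of k] assms[of k j] by linarith
  qed
  have "ent (X ^ Suc b) i j = 0" for i j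
  proof (rule ccontr)
    assume nz: "ent (X ^ Suc b) i j \<noteq> 0"
    have "ent (X ^ Suc b) i j = (\<Sum>k | ent (X ^ b) i k \<noteq> 0. ent (X ^ b) i k * ent X k j)"
      unfolding power_Suc2 times_rfmat.rep_eq ..
    with nz have "(\<Sum>k | ent (X ^ b) i k \<noteq> 0. ent (X ^ b) i k * ent X k j) \<noteq> 0"
      by simp
    then obtain k where "ent (X ^ b) i k * ent X k j \<noteq> 0"
      by (rule sum.not_neutral_contains_not_neutral)
    then have "ent X k j \<noteq> 0" by auto
    then show False using assms[of k j] step[OF nz] by linarith
  qed
  then show ?thesis by (auto intro!: rfmat_eqI simp: ent_simps)
qed

text \<open>The field \<open>F\<close> sits inside the ring with its own unit \<open>e\<close>; it is a field with 2, 3 or 5 elements in the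
application.\<close>

locale small_field =
  fixes F :: "'a::ring_1 set" and e :: 'a
  assumes comm: "\<And>x y :: 'a. x * y = y * x"
    and F_zero: "0 \<in> F" and F_one: "e \<in> F"
    and F_add: "\<And>x y. x \<in> F \<Longrightarrow> y \<in> F \<Longrightarrow> x + y \<in> F"
    and F_uminus: "\<And>x. x \<in> F \<Longrightarrow> - x \<in> F"
    and F_mult: "\<And>x y. x \<in> F \<Longrightarrow> y \<in> F \<Longrightarrow> x * y \<in> F"
    and F_unit: "\<And>x. x \<in> F \<Longrightarrow> e * x = x"
    and F_inverse: "\<And>x. x \<in> F \<Longrightarrow> x \<noteq> 0 \<Longrightarrow> \<exists>y\<in>F. y * x = e"
    and F_small: "\<And>x. x \<in> F \<Longrightarrow> \<exists>c::int. - 2 \<le> c \<and> c \<le> 2 \<and> x = of_int c * e"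
begin

lemma F_sum: "(\<And>k. k \<in> S \<Longrightarrow> f k \<in> F) \<Longrightarrow> sum f S \<in> F"
  by (induction S rule: infinite_finite_induct) (auto intro: F_zero F_add)

definition F_mat :: "nat \<Rightarrow> 'a rfmat \<Rightarrow> bool" where
  "F_mat n X \<longleftrightarrow> supp_less n X \<and> (\<forall>i j. ent X i j \<in> F)"

lemma F_mat_in_corner: "F_mat n X \<Longrightarrow> in_corner (diag_rfmat n e) X"
  using F_unit comm by (simp add: F_mat_def in_corner_diag_iff) metis

lemma F_mat_mk: "(\<And>i j. i < n \<Longrightarrow> j < n \<Longrightarrow> f i j \<in> F) \<Longrightarrow> F_mat n (mk_rfmat n f)"
  by (auto simp: F_mat_def supp_less_def ent_mk_rfmat F_zero split: if_splits)

lemma F_mat_add: "F_mat n X \<Longrightarrow> F_mat n Y \<Longrightarrow> F_mat n (X + Y)"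
  by (auto simp: F_mat_def supp_less_def ent_simps intro: F_add) (metis add.right_neutral)+

lemma F_mat_diff: "F_mat n X \<Longrightarrow> F_mat n Y \<Longrightarrow> F_mat n (X - Y)"
  using F_add[OF _ F_uminus]
  by (auto simp: F_mat_def supp_less_def ent_simps) (metis diff_self)+

lemma F_mat_mult:
  assumes "F_mat n X" "F_mat n Y"
  shows "F_mat n (X * Y)"
proof -
  have X: "supp_less n X" using assms by (simp add: F_mat_def)
  have "i < n \<and> j < n" if "ent (X * Y) i j \<noteq> 0" for i j
  proof -
    from that obtain k where "ent X i k * ent Y k j \<noteq> 0"
      unfolding ent_mult_supp[OF X] by (rule sum.not_neutral_contains_not_neutral)
    then have "ent X i k \<noteq> 0" "ent Y k j \<noteq> 0" by auto
    then show ?thesis using assms by (auto simp: F_mat_def supp_less_def)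
  qed
  moreover have "ent (X * Y) i j \<in> F" for i j
    unfolding ent_mult_supp[OF X] using assms by (auto simp: F_mat_def intro!: F_sum F_mult)
  ultimately show ?thesis by (auto simp: F_mat_def supp_less_def)
qed

text \<open>Conjugation by \<open>1 + y e\<^sub>m\<^sup>T\<close>, whose inverse is \<open>1 - y e\<^sub>m\<^sup>T\<close> because \<open>y\<^sub>m = 0\<close>. Apart from column \<open>m\<close> it has the effect of
row operations with row \<open>m\<close>.\<close>

lemma transvection:
  assumes A: "F_mat n A" and y: "\<And>i. y i \<in> F" "\<And>i. i \<ge> n \<Longrightarrow> y i = 0" "y m = 0" and m: "m < n"
  shows "\<exists>A'. F_mat n A' \<and> (\<forall>i j. j \<noteq> m \<longrightarrow> ent A' i j = ent A i j - y i * ent A m j) \<and>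
    (splits (diag_rfmat n e) A' \<longrightarrow> splits (diag_rfmat n e) A)"
proof -
  define I where "I = diag_rfmat n e"
  define X where "X = mk_rfmat n (\<lambda>i j. if j = m then y i else 0)"
  have entX: "ent X i j = (if j = m then y i else 0)" for i j
    using y(2)[of i] m by (auto simp: X_def ent_mk_rfmat)
  have X: "F_mat n X"
    unfolding X_def by (rule F_mat_mk) (auto simp: y F_zero)
  have I: "F_mat n I"
    unfolding I_def diag_rfmat_def by (rule F_mat_mk) (auto simp: F_one F_zero)
  have IC: "in_corner I Y" if "F_mat n Y" for Y
    using F_mat_in_corner[OF that] by (simp add: I_def)
  have XX: "X * X = 0"
    by (rule rfmat_eqI) (use X in \<open>auto simp: F_mat_def ent_mult_supp[of n X] entX ent_simps y(3) intro!: sum.neutral\<close>)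
  have IX: "I * X = X" "X * I = X" and IA: "A * I = A" and II: "I * I = I"
    using F_mat_in_corner X A I by (auto simp: in_corner_def I_def)
  define A' where "A' = (I - X) * A * (I + X)"
  have "F_mat n A'"
    unfolding A'_def by (intro F_mat_mult F_mat_add F_mat_diff A X I)
  moreover have "ent A' i j = ent A i j - y i * ent A m j" if "j \<noteq> m" for i j
  proof -
    define B where "B = A + A * X"
    have "ent (A * X) i j = 0" for i
      using A that by (simp add: F_mat_def ent_mult_supp[of n A] entX)
    then have B: "ent B i j = ent A i j" for i
      by (simp add: B_def ent_simps)
    have "I * B = B"
      using F_mat_in_corner[OF A] by (simp add: B_def I_def in_corner_def distrib_left flip: mult.assoc)
    then have "A' = B - X * B"
      by (simp add: A'_def B_def distrib_left left_diff_distrib IA mult.assoc)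
    moreover have "ent (X * B) i j = (\<Sum>k<n. ent X i k * ent B k j)"
      using X by (intro ent_mult_supp) (simp add: F_mat_def)
    then have "ent (X * B) i j = (\<Sum>k<n. if k = m then y i * ent B m j else 0)"
      by (simp add: entX if_distrib[of "\<lambda>z. z * _"] cong: if_cong)
    ultimately show ?thesis using m by (simp add: ent_simps B)
  qed
  moreover have "splits I A" if "splits I A'"
  proof (rule splits_conj[OF _ _ _ _ _ that[unfolded A'_def]])
    show "in_corner I (I + X)" "in_corner I (I - X)" "in_corner I A"
      by (intro IC F_mat_add F_mat_diff A X I)+
    show "(I + X) * (I - X) = I" "(I - X) * (I + X) = I"
      by (simp_all add: algebra_simps IX XX II)
  qed
  ultimately show ?thesis unfolding I_def by blast
qed

definition good_column :: "'a rfmat \<Rightarrow> nat \<Rightarrow> bool" where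
  "good_column A j \<longleftrightarrow> (\<forall>i>j. ent A i j = 0) \<or> (\<forall>i. i \<noteq> Suc j \<longrightarrow> ent A i j = 0)"

lemma good_column_below:
  "good_column A j \<Longrightarrow> j < k \<Longrightarrow> k < m \<Longrightarrow> ent A m j = 0"
  unfolding good_column_def by (metis Suc_lessI less_trans nat_neq_iff order.strict_iff_order less_irrefl)

text \<open>Let \<open>E\<close> be the set of columns that vanish below the diagonal. For \<open>j \<in> E\<close> the diagonal entry is
written as \<open>s + t\<close> with \<open>s \<in> {1, -1}\<close> and \<open>t \<in> {-1, 0, 1}\<close>. The sum of \<open>s\<close> on the diagonal and of the entries of column
\<open>j\<close> in rows above the diagonal and outside \<open>E\<close> goes to \<open>p - q\<close>, and \<open>t\<close> goes to \<open>p' - q'\<close>. Because a column in \<open>E\<close> only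
meets rows outside \<open>E\<close> off the diagonal, products of such matrices are computed by their diagonal entries
alone. All other entries form \<open>N\<close>: the columns outside \<open>E\<close>, which lead from \<open>j\<close> to
\<open>j + 1\<close>, and the entries of columns in \<open>E\<close> that lead to a smaller index in \<open>E\<close>. Grouping the indices into blocks
that end at the elements of \<open>E\<close>, each step of \<open>N\<close> either moves forward within a block or moves to an earlier block,
so \<open>N\<close> is nilpotent.\<close>

lemma splits_good:
  assumes A: "F_mat n A" and good: "\<And>j. j < n \<Longrightarrow> good_column A j"
  shows "splits (diag_rfmat n e) A"
proof -
  define E where "E = {j. \<forall>i>j. ent A i j = 0}"
  have A_E: "ent A i j = 0" if "j \<in> E" "j < i" for i j
    using that by (simp add: E_def)
  have A_nE: "ent A i j = 0" if "j \<notin> E" "i \<noteq> Suc j" for i j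
    using that good[of j] A by (cases "j < n") (auto simp: E_def good_column_def F_mat_def supp_less_def)
  have A_out: "ent A i j = 0" if "n \<le> i \<or> n \<le> j" for i j
    using that A unfolding F_mat_def supp_less_def by (meson leD)
  have "\<forall>j. \<exists>c::int. - 2 \<le> c \<and> c \<le> 2 \<and> ent A j j = of_int c * e"
    using A F_small by (auto simp: F_mat_def)
  then obtain c :: "nat \<Rightarrow> int" where c: "\<And>j. - 2 \<le> c j \<and> c j \<le> 2" "\<And>j. ent A j j = of_int (c j) * e"
    by metis
  have ee: "e * e = e" using F_unit F_one by blast
  define col where "col C f = mk_rfmat n (\<lambda>i j. if j \<in> C then if i = j then e
      else if i < j \<and> i \<notin> E then f (ent A i j) else 0 else 0)" for C f
  have col_F: "F_mat n (col C f)" if "\<And>x. x \<in> F \<Longrightarrow> f x \<in> F" for C f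
    unfolding col_def by (rule F_mat_mk) (use A that F_one F_zero in \<open>auto simp: F_mat_def\<close>)
  have col_mult: "ent (col C f * col C' g) i j = (if j \<in> C then ent (col C' g) j j * ent (col C f) i j else 0)"
    if "C \<subseteq> E" "C' \<subseteq> E" "\<And>x. x \<in> F \<Longrightarrow> f x \<in> F" for C C' f g i j
  proof -
    have "ent (col C f * col C' g) i j = (\<Sum>k<n. ent (col C f) i k * ent (col C' g) k j)"
      by (rule ent_mult_supp) (use col_F[OF that(3)] in \<open>auto simp: F_mat_def\<close>)
    also have "\<dots> = (\<Sum>k<n. if k = j then ent (col C f) i j * ent (col C' g) j j else 0)"
      by (rule sum.cong) (use that in \<open>auto simp: col_def ent_mk_rfmat\<close>)
    also have "\<dots> = ent (col C f) i j * ent (col C' g) j j"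
      by (auto simp: col_def ent_mk_rfmat)
    also have "\<dots> = (if j \<in> C then ent (col C' g) j j * ent (col C f) i j else 0)"
      by (auto simp: comm) (auto simp: col_def ent_mk_rfmat)
    finally show ?thesis .
  qed
  have col_orth: "orthogonal_idempotents (diag_rfmat n e) (col C f) (col C' g)"
    if "C \<subseteq> E" "C' \<subseteq> E" "C \<inter> C' = {}" "\<And>x. x \<in> F \<Longrightarrow> f x \<in> F" "\<And>x. x \<in> F \<Longrightarrow> g x \<in> F" for C C' f g
  proof -
    have idem: "col C f * col C f = col C f" if "C \<subseteq> E" "\<And>x. x \<in> F \<Longrightarrow> f x \<in> F" for C f
    proof (rule rfmat_eqI)
      fix i j
      have "ent (col C f) i j \<in> F" using col_F[OF that(2)] by (simp add: F_mat_def)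
      moreover have "ent (col C f * col C f) i j =
          (if j \<in> C then ent (col C f) j j * ent (col C f) i j else 0)"
        using that by (intro col_mult)
      ultimately show "ent (col C f * col C f) i j = ent (col C f) i j"
        using F_unit by (auto simp: col_def ent_mk_rfmat)
    qed
    have zero: "col C f * col C' g = 0"
      if "C \<subseteq> E" "C' \<subseteq> E" "C \<inter> C' = {}" "\<And>x. x \<in> F \<Longrightarrow> f x \<in> F" for C C' f g
    proof (rule rfmat_eqI)
      fix i j
      have "ent (col C f * col C' g) i j =
          (if j \<in> C then ent (col C' g) j j * ent (col C f) i j else 0)"
        using that by (intro col_mult)
      moreover have "ent (col C' g) j j = 0" if "j \<in> C"
        using that \<open>C \<inter> C' = {}\<close> by (auto simp: col_def ent_mk_rfmat)
      ultimately show "ent (col C f * col C' g) i j = ent 0 i j"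
        by (simp add: ent_simps)
    qed
    have "col C f * col C' g = 0" "col C' g * col C f = 0"
      using that by (intro zero; auto)+
    then show ?thesis
      using idem that by (auto simp: orthogonal_idempotents_def intro!: F_mat_in_corner col_F)
  qed
  define N where "N = mk_rfmat n (\<lambda>i j. if j \<in> E \<and> (i \<notin> E \<or> i = j) then 0 else ent A i j)"
  have "F_mat n N"
    unfolding N_def by (rule F_mat_mk) (use A F_zero in \<open>auto simp: F_mat_def\<close>)
  then have N: "in_corner (diag_rfmat n e) N" by (rule F_mat_in_corner)
  \<comment> \<open>The rank counts the earlier blocks, with weight n, and then the distance from the right end.\<close>
  define \<rho> where "\<rho> j = n * card (E \<inter> {..<j}) + (n - j)" for j
  have rank: "\<rho> i < \<rho> j \<and> \<rho> j < n * n + n + 1" if "ent N i j \<noteq> 0" for i j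
  proof
    have ij: "i < n" "j < n" "ent A i j \<noteq> 0" "j \<notin> E \<or> (i \<in> E \<and> i \<noteq> j)"
      using that by (auto simp: N_def ent_mk_rfmat split: if_splits)
    show "\<rho> i < \<rho> j"
    proof (cases "j \<in> E")
      case True
      then have "i \<in> E" "i < j" using ij A_E[of j i] by (auto simp: nat_neq_iff)
      then have "insert i (E \<inter> {..<i}) \<subseteq> E \<inter> {..<j}" by auto
      then have "card (insert i (E \<inter> {..<i})) \<le> card (E \<inter> {..<j})" by (intro card_mono) auto
      then have "Suc (card (E \<inter> {..<i})) \<le> card (E \<inter> {..<j})" by simp
      then have "n * Suc (card (E \<inter> {..<i})) \<le> n * card (E \<inter> {..<j})" by (rule mult_le_mono2)
      then show ?thesis using ij by (simp add: \<rho>_def)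
    next
      case False
      then have "i = Suc j" using ij A_nE by blast
      moreover have "E \<inter> {..<Suc j} = E \<inter> {..<j}" using False by (auto simp: less_Suc_eq)
      ultimately show ?thesis using ij by (simp add: \<rho>_def)
    qed
    have "card (E \<inter> {..<j}) \<le> card {..<j}" by (rule card_mono) auto
    then have "card (E \<inter> {..<j}) \<le> n" using ij by simp
    then have "n * card (E \<inter> {..<j}) \<le> n * n" by (rule mult_le_mono2)
    then show "\<rho> j < n * n + n + 1" unfolding \<rho>_def by linarith
  qed
  have nil: "N ^ Suc (n * n + n + 1) = 0" using rank by (rule nilpotent_of_rank)
  \<comment> \<open>The sign s is 1 for diagonal entries 0, 1, 2 and -1 for -1, -2; the residual values t are -1, 0, 1 and 0, -1.\<close>
  define p where "p = col {j \<in> E. c j \<ge> 0} (\<lambda>x. x)"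
  define q where "q = col {j \<in> E. c j < 0} uminus"
  define p' where "p' = col {j \<in> E. c j = 2} (\<lambda>x. 0)"
  define q' where "q' = col {j \<in> E. c j = 0 \<or> c j = - 2} (\<lambda>x. 0)"
  have pq: "orthogonal_idempotents (diag_rfmat n e) p q"
    unfolding p_def q_def by (rule col_orth) (auto intro: F_uminus)
  have p'q': "orthogonal_idempotents (diag_rfmat n e) p' q'"
    unfolding p'_def q'_def by (rule col_orth) (auto intro: F_zero)
  have "A = (p - q) + (p' - q') + N"
  proof (rule rfmat_eqI)
    fix i j
    show "ent A i j = ent ((p - q) + (p' - q') + N) i j"
    proof (cases "i < n \<and> j < n")
      case ij: True
      note ents = p_def q_def p'_def q'_def N_def col_def ent_simps ent_mk_rfmat
      consider "j \<notin> E" | "j \<in> E" "i = j" | "j \<in> E" "j < i" | "j \<in> E" "i < j"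
        by (metis nat_neq_iff)
      then show ?thesis
      proof cases
        case 2
        have "c j = - 2 \<or> c j = - 1 \<or> c j = 0 \<or> c j = 1 \<or> c j = 2"
          using c(1)[of j] by arith
        then show ?thesis
          using 2 ij c(2)[of j] by (auto simp: ents mult_2)
      qed (use ij A_E in \<open>auto simp: ents\<close>)
    qed (auto simp: A_out p_def q_def p'_def q'_def N_def col_def ent_simps ent_mk_rfmat)
  qed
  with pq p'q' N nil show ?thesis
    unfolding splits_def by blast
qed

text \<open>The columns are treated from left to right, \<open>k\<close> being the number of those already in good form. If column \<open>k\<close> has an entry
below the diagonal, one transvection makes the entry at \<open>k + 1\<close> nonzero and another one clears the rest
of the column. Both only involve row operations with rows in which the earlier columns are zero and the column
operations only affect later columns.\<close>

lemma splits_F_mat: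
  assumes "F_mat n A" "k \<le> n" "\<And>j. j < k \<Longrightarrow> good_column A j"
  shows "splits (diag_rfmat n e) A"
  using assms
proof (induction "n - k" arbitrary: k A)
  case 0
  then show ?case using splits_good by simp
next
  case (Suc d)
  then have k: "k < n" by linarith
  have next_step: "splits (diag_rfmat n e) A'" if "F_mat n A'" "good_column A' k"
    "\<And>j. j < k \<Longrightarrow> good_column A' j" for A'
  proof (rule Suc.hyps(1)[of "Suc k" A'])
    show "d = n - Suc k" using Suc.hyps(2) by simp
  qed (use that k in \<open>auto simp: less_Suc_eq\<close>)
  have keep: "good_column A' j" if "\<And>i. ent A' i j = ent A i j" "j < k" for A' j
    using that Suc.prems(3)[of j] by (simp add: good_column_def)
  have A0: "ent A m j = 0" if "j < k" "k < m" for m j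
    using good_column_below Suc.prems(3) that by blast
  have AF: "ent A i j \<in> F" for i j using Suc.prems(1) by (simp add: F_mat_def)
  have A_out: "ent A i j = 0" if "n \<le> i" for i j
    using that Suc.prems(1) unfolding F_mat_def supp_less_def by (meson leD)
  (* Once the entry below the diagonal is invertible, it clears the rest of its column. *)
  have clear: "splits (diag_rfmat n e) B"
    if B: "F_mat n B" "ent B (Suc k) k \<noteq> 0" "\<And>i j. j < k \<Longrightarrow> ent B i j = ent A i j" for B
  proof -
    have BF: "ent B i j \<in> F" for i j using B(1) by (simp add: F_mat_def)
    have Sk: "Suc k < n" using B by (auto simp: F_mat_def supp_less_def)
    obtain w where w: "w \<in> F" "w * ent B (Suc k) k = e"
      using F_inverse[OF BF B(2)] by blast
    define y where "y i = (if i = Suc k then 0 else ent B i k * w)" for i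
    have "y i \<in> F" for i using w(1) BF by (simp add: y_def F_zero F_mult)
    moreover have "y i = 0" if "i \<ge> n" for i
    proof -
      have "ent B i k = 0" using that B(1) unfolding F_mat_def supp_less_def by (meson leD)
      then show ?thesis by (simp add: y_def)
    qed
    ultimately obtain B' where B': "F_mat n B'"
      "\<And>i j. j \<noteq> Suc k \<Longrightarrow> ent B' i j = ent B i j - y i * ent B (Suc k) j"
      "splits (diag_rfmat n e) B' \<Longrightarrow> splits (diag_rfmat n e) B"
      using transvection[OF B(1), of y "Suc k"] Sk by (auto simp: y_def)
    have "ent B' i k = 0" if "i \<noteq> Suc k" for i
      using B'(2)[of k i] that w(2) F_unit[OF BF] by (simp add: y_def mult.assoc comm[of _ e])
    then have "good_column B' k" by (simp add: good_column_def)
    moreover have "good_column B' j" if "j < k" for j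
      using that B(3) B'(2) A0[of j "Suc k"] by (intro keep) auto
    ultimately show ?thesis using B'(1,3) next_step by blast
  qed
  show ?case
  proof (cases "\<exists>l>k. ent A l k \<noteq> 0")
    case False
    then have "good_column A k" by (auto simp: good_column_def)
    then show ?thesis using Suc.prems next_step by blast
  next
    case True
    then obtain l where l: "l > k" "ent A l k \<noteq> 0" by blast
    show ?thesis
    proof (cases "ent A (Suc k) k = 0")
      case False
      then show ?thesis using clear Suc.prems(1) by blast
    next
      case True
      then have "l \<noteq> Suc k" "l < n"
        using l A_out[of l k] by (auto simp: not_le[symmetric])
      then have l': "l \<noteq> Suc k" "l < n" "Suc k < n" using l by auto
      define y where "y i = (if i = Suc k then - e else 0)" for i
      have "y i \<in> F" for i by (simp add: y_def F_zero F_one F_uminus)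
      then obtain B where B: "F_mat n B"
        "\<And>i j. j \<noteq> l \<Longrightarrow> ent B i j = ent A i j - y i * ent A l j"
        "splits (diag_rfmat n e) B \<Longrightarrow> splits (diag_rfmat n e) A"
        using transvection[OF Suc.prems(1), of y l] l' by (auto simp: y_def)
      have "ent B (Suc k) k = ent A l k"
        using B(2)[of k "Suc k"] l True F_unit[OF AF] by (simp add: y_def)
      then have "splits (diag_rfmat n e) B"
        using l B(1,2) A0 by (intro clear) auto
      then show ?thesis by (rule B(3))
    qed
  qed
qed

end

section \<open>From small fields to the whole ring\<close>

lemma small_field_multiples:
  fixes e :: "'a::ring_1" and p :: int
  assumes comm: "\<And>x y :: 'a. x * y = y * x" and e: "e * e = e"
    and p: "prime p" "p \<le> 5" "of_int p * e = 0"
  shows "small_field (range (\<lambda>c::int. of_int c * e)) e"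
proof
  fix x y :: 'a
  let ?F = "range (\<lambda>c::int. of_int c * e)"
  show "x * y = y * x" by (rule comm)
  show "0 \<in> ?F" "e \<in> ?F" by (auto intro: rev_image_eqI[of 0] rev_image_eqI[of 1])
  have ml: "of_int c * e * (of_int d * e) = of_int (c * d) * e" for c d
    by (metis comm e mult.assoc of_int_mult)
  have red: "of_int c * e = of_int d * e" if dvd: "p dvd c - d" for c d
  proof -
    obtain k where "c - d = p * k" using dvd by (rule dvdE)
    then have "c = d + k * p" by (simp add: algebra_simps)
    then show ?thesis by (simp add: distrib_right mult.assoc p(3))
  qed
  show "- x \<in> ?F" if x: "x \<in> ?F"
  proof -
    from x obtain c where "x = of_int c * e" by blast
    then have "- x = of_int (- c) * e" by simp
    then show ?thesis by blast
  qed
  show "e * x = x" if "x \<in> ?F"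
    using that ml[of 1] by auto
  show "\<exists>y\<in>?F. y * x = e" if x: "x \<in> ?F" "x \<noteq> 0"
  proof -
    from x obtain c where c: "x = of_int c * e" by blast
    then have "\<not> p dvd c" using x red[of c 0] by auto
    then have "coprime c p" using p(1) prime_imp_coprime coprime_commute by blast
    then obtain d where "[c * d = 1] (mod p)" using cong_solve_coprime_int by blast
    then have "p dvd d * c - 1" by (simp add: cong_iff_dvd_diff mult.commute)
    then have "of_int d * e * x = e" using red[of "d * c" 1] unfolding c ml by simp
    then show ?thesis by blast
  qed
  show "\<exists>c. - 2 \<le> c \<and> c \<le> 2 \<and> x = of_int c * e" if x: "x \<in> ?F"
  proof -
    from x obtain c where c: "x = of_int c * e" by blast
    define d where "d = (c + 2) mod p - 2"
    have "p > 0" using p(1) by (simp add: prime_gt_0_int)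
    then have "- 2 \<le> d" "d \<le> 2"
      using pos_mod_bound[of p "c + 2"] pos_mod_sign[of p "c + 2"] p(2) unfolding d_def by linarith+
    moreover have "c - d = p * ((c + 2) div p)"
      using minus_mod_eq_mult_div[of "c + 2" p] by (simp add: d_def)
    then have "x = of_int d * e" using red[of c d] c by simp
    ultimately show ?thesis by blast
  qed
  show "x + y \<in> ?F" "x * y \<in> ?F" if xy: "x \<in> ?F" "y \<in> ?F"
  proof -
    from xy obtain c d where cd: "x = of_int c * e" "y = of_int d * e" by blast
    have "x + y = of_int (c + d) * e" "x * y = of_int (c * d) * e"
      unfolding cd ml by (simp_all add: distrib_right)
    then show "x + y \<in> ?F" "x * y \<in> ?F" by blast+
  qed
qed

context
  fixes R :: "'a::ring_1 itself"
  assumes semiprime: "\<And>a::'a. (\<And>r. a * r * a = 0) \<Longrightarrow> a = 0"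
    and dec: "\<And>x::'a. sum_of_commuting_2idem x"
begin

lemmas R_comm = commutative[OF semiprime dec]

lemma splits_integral:
  fixes A :: "'a rfmat" and e :: 'a and p :: int
  assumes A: "supp_less n A" and e: "e * e = e" and p: "prime p" "p \<le> 5" "of_int p * e = 0"
    and int: "\<And>i j. \<exists>c::int. e * ent A i j = of_int c * e"
  shows "splits (diag_rfmat n e) (diag_rfmat n e * A)"
proof -
  interpret small_field "range (\<lambda>c::int. of_int c * e)" e
    by (rule small_field_multiples[OF R_comm e p])
  have A0: "ent A i j = 0" if "\<not> i < n \<or> \<not> j < n" for i j
    using A that unfolding supp_less_def by blast
  have ent: "ent (diag_rfmat n e * A) i j = e * ent A i j" for i j
    using A0[of i j] by (cases "i < n") (auto simp: ent_diag_mult)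
  have "supp_less n (diag_rfmat n e * A)"
    unfolding supp_less_def ent by (metis A0 mult_zero_right)
  moreover have "ent (diag_rfmat n e * A) i j \<in> range (\<lambda>c::int. of_int c * e)" for i j
    using int[of i j] unfolding ent by blast
  ultimately have "F_mat n (diag_rfmat n e * A)"
    unfolding F_mat_def by blast
  then show ?thesis by (rule splits_F_mat[of n _ 0]) auto
qed

lemma splits_diag_add:
  fixes A :: "'a rfmat"
  assumes "e * f = 0" "splits (diag_rfmat n e) (diag_rfmat n e * A)"
    "splits (diag_rfmat n f) (diag_rfmat n f * A)"
  shows "splits (diag_rfmat n (e + f)) (diag_rfmat n (e + f) * A)"
proof -
  have "diag_rfmat n (e + f) = diag_rfmat n e + diag_rfmat n f"
    by (rule rfmat_eqI) (simp add: ent_diag ent_simps)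
  moreover have "diag_rfmat n e * diag_rfmat n f = 0" "diag_rfmat n f * diag_rfmat n e = 0"
    using assms(1) R_comm[of f e] by (auto intro!: rfmat_eqI simp: ent_diag_mult ent_diag ent_simps)
  ultimately show ?thesis
    using splits_add[OF assms(2,3)] by (simp add: distrib_right)
qed

text \<open>A tripotent \<open>t\<close> cuts \<open>e\<close> into three orthogonal idempotents on which it equals 1, -1 and 0.\<close>

lemma tripotent_induct:
  assumes add: "\<And>e f. e * f = 0 \<Longrightarrow> P e \<Longrightarrow> P f \<Longrightarrow> P (e + f)"
    and t: "t * (t * t) = t" and e: "e * e = (e :: 'a)"
    and P: "\<And>f. f * f = f \<Longrightarrow> e * f = f \<Longrightarrow> (\<exists>c::int. f * t = of_int c * f) \<Longrightarrow> P f"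
  shows "P e"
proof -
  define g where "g = 8 * (t * t + t)"
  note ts = tripotent_split[OF semiprime dec t, folded g_def]
  have tttt: "t * t * (t * t) = t * t" using t by (metis mult.assoc)
  define h where "h = t * t - g"
  have gt: "t * t * g = g" using ts(2) by (simp add: mult.assoc)
  have h: "h * h = h" "g * h = 0" "t * h = - h"
    using ts tttt gt R_comm[of g "t * t"] by (simp_all add: h_def algebra_simps)
  define k where "k = 1 - t * t"
  have k: "k * k = k" "t * k = 0" "g * k = 0" "h * k = 0"
    using t tttt gt R_comm[of g "t * t"] by (simp_all add: k_def h_def algebra_simps)
  have mult: "(e * x) * (e * y) = e * (x * y)" for x y
    by (metis R_comm e mult.assoc)
  have et: "e * x * t = e * (t * x)" for x by (metis R_comm mult.assoc)
  have ee: "e * (e * x) = e * x" for x by (metis e mult.assoc)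
  have "P (e * g)"
  proof (rule P)
    have "e * g * t = of_int 1 * (e * g)" by (simp add: et ts(2))
    then show "\<exists>c::int. e * g * t = of_int c * (e * g)" by blast
  qed (simp_all add: mult ee ts(1))
  moreover have "P (e * h)"
  proof (rule P)
    have "e * h * t = of_int (- 1) * (e * h)" by (simp add: et h)
    then show "\<exists>c::int. e * h * t = of_int c * (e * h)" by blast
  qed (simp_all add: mult ee h)
  moreover have "P (e * k)"
  proof (rule P)
    have "e * k * t = of_int 0 * (e * k)" by (simp add: et k)
    then show "\<exists>c::int. e * k * t = of_int c * (e * k)" by blast
  qed (simp_all add: mult ee k)
  moreover have "e * h * (e * k) = 0" "e * g * (e * h + e * k) = 0"
    by (simp_all add: distrib_left mult h k)
  ultimately have "P (e * g + (e * h + e * k))" by (intro add)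
  moreover have "e * g + (e * h + e * k) = e * (g + (h + k))" by (simp add: distrib_left)
  moreover have "g + (h + k) = 1" by (simp add: h_def k_def)
  ultimately show ?thesis by simp
qed

text \<open>Each element is a sum of two tripotents, and \<open>tripotent_induct\<close> makes both integral on small enough
idempotents; smaller idempotents preserve what is already integral. This replaces the decomposition of a
finite commutative reduced ring into fields.\<close>

lemma integral_induct:
  assumes add: "\<And>e f. e * f = 0 \<Longrightarrow> P e \<Longrightarrow> P f \<Longrightarrow> P (e + f)"
    and e: "e * e = (e :: 'a)"
    and P: "\<And>f. f * f = f \<Longrightarrow> e * f = f \<Longrightarrow> (\<And>x. x \<in> set xs \<Longrightarrow> \<exists>c::int. f * x = of_int c * f) \<Longrightarrow> P f"
  shows "P e"
  using e P
proof (induction xs arbitrary: e)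
  case Nil
  then show ?case by simp
next
  case (Cons x xs)
  obtain s t where st: "x = s + t" "s * (s * s) = s" "t * (t * t) = t"
    using sum_of_two_tripotents[OF semiprime dec] by blast
  have below: "\<exists>c::int. g * x = of_int c * g" if "\<exists>c::int. f * x = of_int c * f" "f * g = g" for f g x :: 'a
    using that by (metis R_comm mult.assoc)
  show ?case
  proof (rule Cons.IH[OF Cons.prems(1)])
    fix f assume f: "f * f = f" "e * f = f" "\<And>x. x \<in> set xs \<Longrightarrow> \<exists>c::int. f * x = of_int c * f"
    show "P f"
    proof (rule tripotent_induct[where P = P, OF add st(2) f(1)])
      fix g assume g: "g * g = g" "f * g = g" "\<exists>c::int. g * s = of_int c * g"
      show "P g"
      proof (rule tripotent_induct[where P = P, OF add st(3) g(1)])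
        fix h assume h: "h * h = h" "g * h = h" "\<exists>c::int. h * t = of_int c * h"
        have fh: "f * h = h" using g(2) h(2) by (metis mult.assoc)
        show "P h"
        proof (rule Cons.prems(2))
          show "h * h = h" by (rule h(1))
          show "e * h = h" using f(2) fh by (metis mult.assoc)
          fix y assume "y \<in> set (x # xs)"
          then consider "y = x" | "y \<in> set xs" by auto
          then show "\<exists>c::int. h * y = of_int c * h"
          proof cases
            case 1
            obtain c d :: int where "h * s = of_int c * h" "h * t = of_int d * h"
              using below[OF g(3) h(2)] h(3) by blast
            then have "h * y = of_int (c + d) * h"
              by (simp add: 1 st(1) distrib_left distrib_right)
            then show ?thesis by blast
          next
            case 2
            then show ?thesis using below[OF f(3) fh] by blast
          qed
        qed
      qed assumption
    qed assumption
  qed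
qed

lemma splits_semiprime:
  fixes A :: "'a rfmat"
  assumes A: "supp_less n A"
  shows "splits (diag_rfmat n 1) A"
proof -
  define P where "P e = splits (diag_rfmat n e) (diag_rfmat n e * A)" for e
  have add: "P (e + f)" if "e * f = 0" "P e" "P f" for e f
    using splits_diag_add that by (simp add: P_def)
  obtain xs where xs: "set xs = (\<lambda>(i, j). ent A i j) ` ({..<n} \<times> {..<n})"
    using finite_list[of "(\<lambda>(i, j). ent A i j) ` ({..<n} \<times> {..<n})"] by auto
  have "P 1"
  proof (rule integral_induct[of P 1 xs, OF add])
    fix f :: 'a assume f: "f * f = f" "\<And>x. x \<in> set xs \<Longrightarrow> \<exists>c::int. f * x = of_int c * f"
    have int: "\<exists>c::int. f * ent A i j = of_int c * f" for i j
    proof (cases "i < n \<and> j < n")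
      case True
      then show ?thesis using f(2) xs by auto
    next
      case False
      then have "ent A i j = 0" using A by (auto simp: supp_less_def)
      then show ?thesis by (intro exI[of _ 0]) simp
    qed
    have 30: "(30 :: 'a) = 0" by (rule thirty_eq_0[OF semiprime dec])
    have z: "of_int c * f = 0" if "30 dvd c" for c :: int
      using that 30 by (auto simp: dvd_def)
    have prod: "of_int c * f * (of_int d * f) = of_int (c * d) * f" for c d :: int
      by (metis R_comm f(1) mult.assoc of_int_mult)
    have part: "P (of_int c * f)" if cp: "prime p" "p \<le> 5" "30 dvd p * c" "30 dvd c * c - c" for c p :: int
      unfolding P_def
    proof (rule splits_integral[OF A _ cp(1,2)])
      show "of_int c * f * (of_int c * f) = of_int c * f"
        using z[OF cp(4)] by (simp add: prod left_diff_distrib)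
      show "of_int p * (of_int c * f) = 0"
        using z[OF cp(3)] by (simp add: mult.assoc)
      fix i j
      obtain d :: int where "f * ent A i j = of_int d * f" using int by blast
      then have "of_int c * f * ent A i j = of_int d * (of_int c * f)"
        by (metis R_comm mult.assoc)
      then show "\<exists>d::int. of_int c * f * ent A i j = of_int d * (of_int c * f)" by blast
    qed
    have primes: "prime (2 :: int)" "prime (3 :: int)" "prime (5 :: int)" by simp_all
    (* 15 + 10 + 6 = 1 modulo 30 is the decomposition of 1 into idempotents of characteristic 2, 3, 5. *)
    have "P (of_int 15 * f)" "P (of_int 10 * f)" "P (of_int 6 * f)"
      using part[of 2 15] part[of 3 10] part[of 5 6] primes by simp_all
    then have "P (of_int 15 * f + (of_int 10 * f + of_int 6 * f))"
      by (intro add) (simp_all only: distrib_left prod, simp_all add: z[of 150, simplified] z[of 90, simplified] z[of 60, simplified])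
    moreover have "of_int 15 * f + (of_int 10 * f + of_int 6 * f) = of_int 31 * f"
      by (simp only: of_int_add[symmetric] distrib_right[symmetric]) simp
    moreover have "of_int 31 * f = f"
      using z[of 30] distrib_right[of 30 1 f] by simp
    ultimately show "P f" by simp
  qed simp_all
  moreover have "diag_rfmat n 1 * A = A"
    using in_corner_diag_iff[of n 1 A] A by (simp add: in_corner_def)
  ultimately show ?thesis by (simp add: P_def)
qed

end

lemma sum_of_commuting_2idem_quotient:
  fixes x :: "'a::ring_1 semiprime_quotient"
  assumes "\<And>x::'a. sum_of_commuting_2idem x"
  shows "sum_of_commuting_2idem x"
proof (induction x rule: semiprime_quotient.abs_induct)
  case (1 y)
  interpret q: ring_1_hom "abs_semiprime_quotient :: 'a \<Rightarrow> _" by (rule abs_quotient_hom)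
  obtain e f where "e ^ 4 = e ^ 2" "f ^ 4 = f ^ 2" "e * f = f * e" "y = e + f"
    using assms unfolding sum_of_commuting_2idem_def by blast
  then show ?case unfolding sum_of_commuting_2idem_def by (metis q.hom_add q.hom_mult q.hom_power)
qed

theorem splits_rfmat:
  fixes A :: "'a::ring_1 rfmat"
  assumes "\<And>x::'a. sum_of_commuting_2idem x" "supp_less n A"
  shows "splits (diag_rfmat n 1) A"
proof (rule splits_from_quotient[OF assms(2)])
  have "supp_less n (rfmat_quotient A)"
    unfolding supp_less_def
  proof (intro allI impI)
    fix i j assume "ent (rfmat_quotient A) i j \<noteq> 0"
    then have "ent A i j \<noteq> 0"
      by (auto simp: rfmat_quotient.rep_eq ring_1_hom.hom_zero[OF abs_quotient_hom])
    then show "i < n \<and> j < n" using assms(2) by (auto simp: supp_less_def)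
  qed
  then show "splits (diag_rfmat n 1) (rfmat_quotient A)"
  proof (rule splits_semiprime[rotated 2])
    fix a :: "'a semiprime_quotient"
    assume "\<And>r. a * r * a = 0"
    then show "a = 0" by (rule semiprime_quotient)
  next
    fix x :: "'a semiprime_quotient"
    show "sum_of_commuting_2idem x"
      using assms(1) by (rule sum_of_commuting_2idem_quotient)
  qed
qed

section \<open>Passage to ordinary matrices\<close>

text \<open>The factor \<open>bit\<close>, the field with two elements, will make the product a nonzero ring, so that numerals and
integer multiples are available also when the first factor is the zero ring.\<close>

instantiation prod :: ("{ring, monoid_mult}", ring_1) ring_1
begin

definition one_prod :: "'a \<times> 'b" where "1 = (1, 1)"

definition times_prod :: "'a \<times> 'b \<Rightarrow> 'a \<times> 'b \<Rightarrow> 'a \<times> 'b" where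
  "x * y = (fst x * fst y, snd x * snd y)"

instance
  by standard
    (simp_all add: one_prod_def times_prod_def prod_eq_iff mult.assoc distrib_left distrib_right)

end

lemma power_prod: "x ^ k = (fst x ^ k, snd x ^ k)"
  for x :: "'a::{ring, monoid_mult} \<times> 'b::ring_1"
  by (induction k) (simp_all add: one_prod_def times_prod_def)

lemma sum_of_commuting_2idem_prod_bit:
  fixes x :: "'a::{ring, monoid_mult} \<times> bit"
  assumes "\<forall>x :: 'a. \<exists>e f. two_idempotent e \<and> two_idempotent f \<and> e * f = f * e \<and> x = e + f"
  shows "sum_of_commuting_2idem x"
proof -
  obtain e f where ef: "two_idempotent e" "two_idempotent f" "e * f = f * e" "fst x = e + f"
    using assms by blast
  have "(e, snd x) ^ 4 = (e, snd x) ^ 2" "(f, 0 :: bit) ^ 4 = (f, 0) ^ 2"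
    using ef(1,2) by (cases "snd x"; simp add: two_idempotent_iff power_prod)+
  moreover have "(e, snd x) * (f, 0) = (f, 0) * (e, snd x)" "x = (e, snd x) + (f, 0)"
    using ef(3,4) by (simp_all add: times_prod_def prod_eq_iff)
  ultimately show ?thesis
    unfolding sum_of_commuting_2idem_def by blast
qed

definition fst_mat :: "nat \<Rightarrow> ('a::{ring, monoid_mult} \<times> 'b::ring_1) rfmat \<Rightarrow> 'a mat" where
  "fst_mat n X = mat n n (\<lambda>(i, j). fst (ent X i j))"

lemma fst_mat_carrier: "fst_mat n X \<in> carrier_mat n n"
  by (simp add: fst_mat_def)

lemma fst_mat_add: "fst_mat n (X + Y) = fst_mat n X + fst_mat n Y"
  by (rule eq_matI) (auto simp: fst_mat_def ent_simps)

lemma fst_mat_mult: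
  assumes "in_corner (diag_rfmat n 1) X"
  shows "fst_mat n (X * Y) = fst_mat n X * fst_mat n Y"
proof (rule eq_matI)
  fix i j assume "i < dim_row (fst_mat n X * fst_mat n Y)" "j < dim_col (fst_mat n X * fst_mat n Y)"
  then have ij: "i < n" "j < n" by (auto simp: fst_mat_def)
  have fst_sum: "fst (sum f S) = (\<Sum>k\<in>S. fst (f k))" for f :: "nat \<Rightarrow> 'a \<times> 'b" and S
    by (induction S rule: infinite_finite_induct) auto
  have "ent (X * Y) i j = (\<Sum>k<n. ent X i k * ent Y k j)"
    using assms by (intro ent_mult_supp) (simp add: in_corner_diag_iff)
  then show "fst_mat n (X * Y) $$ (i, j) = (fst_mat n X * fst_mat n Y) $$ (i, j)"
    using ij by (simp add: fst_mat_def scalar_prod_def fst_sum times_prod_def atLeast0LessThan)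
qed (simp_all add: fst_mat_def)

lemma tripotent_fst_mat:
  assumes "orthogonal_idempotents (diag_rfmat n 1) p q"
  shows "tripotent_mat n (fst_mat n (p - q))"
proof -
  have c: "in_corner (diag_rfmat n 1) (p - q)"
    using assms by (simp add: orthogonal_idempotents_def in_corner_def left_diff_distrib right_diff_distrib)
  then have "in_corner (diag_rfmat n 1) ((p - q) * (p - q))"
    using in_corner_mult by blast
  then show ?thesis
    unfolding tripotent_mat_def
    using tripotent_diff[OF assms] by (simp add: fst_mat_carrier c flip: fst_mat_mult)
qed

lemma nilpotent_fst_mat:
  assumes c: "in_corner (diag_rfmat n 1) c" and k: "c ^ k = 0"
  shows "nilpotent_mat n (fst_mat n c)"
proof -
  have D: "in_corner (diag_rfmat n 1) (diag_rfmat n 1 * c ^ m)" for m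
  proof (induction m)
    case 0
    show ?case by (simp add: in_corner_diag_iff supp_less_def ent_diag)
  next
    case (Suc m)
    then show ?case using in_corner_mult[OF Suc c] by (simp add: power_Suc2 mult.assoc del: power_Suc)
  qed
  have "((\<lambda>X. X * fst_mat n c) ^^ m) (1\<^sub>m n) = fst_mat n (diag_rfmat n 1 * c ^ m)" for m
  proof (induction m)
    case 0
    show ?case by (rule eq_matI) (auto simp: fst_mat_def ent_diag one_prod_def)
  next
    case (Suc m)
    then show ?case
      by (simp add: fst_mat_mult[OF D, symmetric] mult.assoc power_Suc2 del: power_Suc)
  qed
  from this[of k] have "((\<lambda>X. X * fst_mat n c) ^^ k) (1\<^sub>m n) = 0\<^sub>m n n"
    unfolding k by (auto simp: fst_mat_def ent_simps intro!: eq_matI)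
  then show ?thesis
    unfolding nilpotent_mat_def using fst_mat_carrier by blast
qed

theorem theorem3p7:
  fixes A :: "'a :: {ring, monoid_mult} mat" and n :: nat
  assumes "\<forall>x :: 'a. \<exists>e f. two_idempotent e \<and> two_idempotent f \<and> e * f = f * e \<and> x = e + f"
    and "n > 0"
    and "A \<in> carrier_mat n n"
  shows "\<exists>S T N. tripotent_mat n S \<and> tripotent_mat n T \<and> nilpotent_mat n N \<and> A = S + T + N"
proof -
  define B where "B = mk_rfmat n (\<lambda>i j. (A $$ (i, j), 0 :: bit))"
  have A: "A = fst_mat n B"
    using assms(3) by (auto intro!: eq_matI simp: fst_mat_def B_def ent_mk_rfmat)
  have "supp_less n B" by (auto simp: supp_less_def B_def ent_mk_rfmat)
  then have "splits (diag_rfmat n 1) B"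
    by (rule splits_rfmat[OF sum_of_commuting_2idem_prod_bit[OF assms(1)]])
  then obtain p q p' q' c k where
    "orthogonal_idempotents (diag_rfmat n 1) p q" "orthogonal_idempotents (diag_rfmat n 1) p' q'"
    "in_corner (diag_rfmat n 1) c" "c ^ k = 0" "B = (p - q) + (p' - q') + c"
    unfolding splits_def by blast
  then show ?thesis
    unfolding A by (metis fst_mat_add nilpotent_fst_mat tripotent_fst_mat)
qed

end
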